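(* Let $\mathcal{H}$ be a real Hilbert space, let $f:\mathcal{H}\to\mathbb{R}\cup\{+\infty\}$ be proper, convex and lower semicontinuous, and let $g:\mathcal{H}\to\mathbb{R}$ be convex and continuously Fréchet differentiable with $L$-Lipschitz continuous gradient ($L>0$). Assume $\operatorname{argmin}(f+g)\neq\emptyset$. Let $(t_k)_{k\ge0}$ be a real sequence with $t_0=1$ and $$t_{k-1}<t_k<\frac{1+\sqrt{1+4t_{k-1}^2}}{2}\quad\text{for all }k\ge1,$$ let $(\varepsilon_k)_{k\ge1}$ be a non-increasing sequence of positive reals with $\lim_{k\to+\infty}\varepsilon_k=0$, and let $0<s<\frac1L$. Let $x_0,x_1\in\mathcal{H}$ and for all $k\ge1$ set $$y_k= x_k+\frac{(t_{k}-1)(t_{k-1}-1)}{t_{k-1}^2}(x_k-x_{k-1})-\frac{-t_{k}^2+t_{k}+t_{k-1}^2}{t_{k-1}^2t_{k}}\, x_k,\qquad x_{k+1}=\operatorname{prox}_{sf}\left(y_k-s\nabla g(y_k)-s\varepsilon_k y_k\right).$$ Let $k_0\ge2$ be an integer such that $s\in\left(0,\frac{1}{L+\varepsilon_{k_0}}\right]$. Assume that $$\liminf_{k\to+\infty}\frac{-t_k^2+t_k+t_{k-1}^2}{t_k}>0,$$ that the sequence $(t_k^2\varepsilon_k)_{k\ge k_0-1}$ is increasing, and that $$\lim_{k\to+\infty}t_k^2\varepsilon_k=+\infty,\qquad \lim_{k\to+\infty}\frac{t_k(\varepsilon_k-\varepsilon_{k+1})}{\varepsilon_k}=0.$$ Then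 $(x_k)$ converges strongly to $x^*$, the minimum norm minimizer of $f+g$, i.e. $\{x^*\}=\operatorname{pr}_{\operatorname{argmin}(f+g)}(0)$. Moreover $\|x_k-y_k\|=o(\sqrt{\varepsilon_k})$ as $k\to+\infty$, hence $(y_k)$ also converges strongly to $x^*$. Further, as $k\to+\infty$, $$F_k(x_k)-F_k(\overline{x}_k)=o(\varepsilon_k),\qquad (f+g)(x_k)-\min(f+g)=\mathcal{O}(\varepsilon_k),\qquad \|x_k-x_{k-1}\|=o(\sqrt{\varepsilon_k}),$$ where $F_k(x)=f(x)+g(x)+\frac{\varepsilon_k}{2}\|x\|^2$ and $\overline{x}_k$ is the unique minimizer of $F_k$, and there exist $u_k\in\partial f(x_k)+\nabla g(x_k)$ ($k\ge2$) such that $\|u_k\|=o(\sqrt{\varepsilon_k})$.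
   Context: For $s>0$, $\operatorname{prox}_{sf}(x)=\operatorname{argmin}_{y\in\mathcal{H}}\left\{f(y)+\frac{1}{2s}\|y-x\|^2\right\}$. $\partial f$ is the convex subdifferential. $\operatorname{pr}_C(0)$ denotes the metric projection of $0$ onto the nonempty closed convex set $C$, i.e. the element of $C$ of minimal norm. *)

theory Defs
  imports "HOL-Analysis.Analysis" "HOL-Library.Landau_Symbols"
begin

definition proper_fun :: "('a \<Rightarrow> ereal) \<Rightarrow> bool" where
  "proper_fun f \<longleftrightarrow> (\<forall>x. f x \<noteq> -\<infinity>) \<and> (\<exists>x. f x \<noteq> \<infinity>)"

text \<open>Used only together with \<open>proper_fun\<close>, so that no sum of opposite infinities occurs on the
  right-hand side; the boundary cases rely on the convention \<open>0 * \<infinity> = 0\<close> of \<open>ereal\<close>.\<close>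

definition convex_fun :: "('a::real_vector \<Rightarrow> ereal) \<Rightarrow> bool" where
  "convex_fun f \<longleftrightarrow> (\<forall>x y. \<forall>u\<ge>0. \<forall>v\<ge>0. u + v = 1 \<longrightarrow>
     f (u *\<^sub>R x + v *\<^sub>R y) \<le> ereal u * f x + ereal v * f y)"

definition lsc_fun :: "('a::topological_space \<Rightarrow> ereal) \<Rightarrow> bool" where
  "lsc_fun f \<longleftrightarrow> (\<forall>x. f x \<le> Liminf (at x) f)"

definition argmin_set :: "('a \<Rightarrow> ereal) \<Rightarrow> 'a set" where
  "argmin_set h = {x. is_arg_min h (\<lambda>_. True) x}"

text \<open>For \<open>s > 0\<close> and \<open>f\<close> proper, convex and lower semicontinuous on a Hilbert space the
  minimizer is unique, so the choice made by \<open>arg_min\<close> is irrelevant.\<close>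

definition prox :: "real \<Rightarrow> ('a::real_inner \<Rightarrow> ereal) \<Rightarrow> 'a \<Rightarrow> 'a" where
  "prox s f x = arg_min (\<lambda>y. f y + ereal (1 / (2 * s) * (norm (y - x))\<^sup>2)) (\<lambda>_. True)"

definition subdifferential :: "('a::real_inner \<Rightarrow> ereal) \<Rightarrow> 'a \<Rightarrow> 'a set" where
  "subdifferential f x =
     {v. \<bar>f x\<bar> \<noteq> \<infinity> \<and> (\<forall>z. f x + ereal (v \<bullet> (z - x)) \<le> f z)}"

text \<open>The library's \<open>closest_point\<close> requires \<open>heine_borel\<close>, which fails in infinite dimension. The
  projection is set-valued here; it is a singleton for nonempty closed convex sets.\<close>

definition metric_proj :: "'a::metric_space set \<Rightarrow> 'a \<Rightarrow> 'a set" where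
  "metric_proj C a = {p \<in> C. \<forall>q\<in>C. dist a p \<le> dist a q}"

end

theory Submission
  imports Defs
begin

text \<open>
  Write \<open>z\<^sub>k = x\<^sub>k\<^sub>-\<^sub>1 + t\<^sub>k\<^sub>-\<^sub>1 (x\<^sub>k - x\<^sub>k\<^sub>-\<^sub>1)\<close> and \<open>\<gamma>\<^sub>k = (t\<^sub>k\<^sub>-\<^sub>1\<^sup>2 + t\<^sub>k - t\<^sub>k\<^sup>2) / t\<^sub>k\<^sub>-\<^sub>1\<^sup>2\<close>. The extrapolation
  rule then reads \<open>t\<^sub>k y\<^sub>k = (t\<^sub>k - 1) x\<^sub>k + (1 - \<gamma>\<^sub>k) z\<^sub>k\<close>: the extra term in \<open>y\<^sub>k\<close> damps \<open>z\<^sub>k\<close> by the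
  factor \<open>1 - \<gamma>\<^sub>k\<close>. Let \<open>q\<close> be the minimum norm minimizer. Comparing the proximal gradient step with
  the point \<open>(1 - 1/t\<^sub>k) x\<^sub>k + (1/t\<^sub>k) q\<close> shows that the energy
  \<open>E\<^sub>k = t\<^sub>k\<^sub>-\<^sub>1\<^sup>2 (F\<^sub>k(x\<^sub>k) - F\<^sub>k(q)) + \<parallel>z\<^sub>k - q\<parallel>\<^sup>2 / (2s)\<close> satisfies
  \<open>E\<^sub>k\<^sub>+\<^sub>1 \<le> (1 - \<gamma>\<^sub>k) E\<^sub>k + \<gamma>\<^sub>k \<parallel>q\<parallel>\<^sup>2 / (2s) + t\<^sub>k\<^sup>2 (\<epsilon>\<^sub>k - \<epsilon>\<^sub>k\<^sub>+\<^sub>1) \<parallel>q\<parallel>\<^sup>2 / 2\<close>.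
  The last two terms are \<open>\<gamma>\<^sub>k o(t\<^sub>k\<^sup>2 \<epsilon>\<^sub>k)\<close>, hence \<open>E\<^sub>k \<le> o(t\<^sub>k\<^sup>2 \<epsilon>\<^sub>k)\<close>. Since the Tikhonov path of minimizers
  of \<open>F\<^sub>k\<close> converges strongly to \<open>q\<close>, also \<open>F\<^sub>k(q) - min F\<^sub>k = o(\<epsilon>\<^sub>k)\<close>. Hence
  \<open>F\<^sub>k(x\<^sub>k) - min F\<^sub>k = o(\<epsilon>\<^sub>k)\<close> and \<open>\<parallel>z\<^sub>k - q\<parallel> = o(t\<^sub>k \<surd>\<epsilon>\<^sub>k)\<close>; strong convexity of \<open>F\<^sub>k\<close> gives
  \<open>x\<^sub>k \<longlonglongrightarrow> q\<close>, and the other estimates follow from the bound on \<open>z\<^sub>k\<close>.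
\<close>

subsection \<open>Convex and strongly convex functions\<close>

text \<open>The last term is the exact strong convexity gain of the squared distance to
  \<open>a\<close>. Every quadratic growth estimate below comes from it.\<close>

lemma norm_sq_convex_combination:
  fixes x y :: "'a::real_inner"
  shows "(norm ((1 - u) *\<^sub>R x + u *\<^sub>R y - a))\<^sup>2 =
    (1 - u) * (norm (x - a))\<^sup>2 + u * (norm (y - a))\<^sup>2 - u * (1 - u) * (norm (y - x))\<^sup>2"
proof -
  define v w where "v = x - a" and "w = y - a"
  have "(1 - u) *\<^sub>R x + u *\<^sub>R y - a = (1 - u) *\<^sub>R v + u *\<^sub>R w" "y - x = w - v"
    by (simp_all add: v_def w_def algebra_simps)
  moreover have "(norm ((1 - u) *\<^sub>R v + u *\<^sub>R w))\<^sup>2 =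
      (1 - u) * (norm v)\<^sup>2 + u * (norm w)\<^sup>2 - u * (1 - u) * (norm (w - v))\<^sup>2"
    unfolding power2_norm_eq_inner
    by (simp add: inner_add inner_diff inner_commute [of w v] algebra_simps)
  ultimately show ?thesis by (simp add: v_def w_def)
qed

lemma GDERIV_along_line:
  fixes g :: "'a::real_inner \<Rightarrow> real"
  assumes "GDERIV g (a + u *\<^sub>R d) :> c"
  shows "((\<lambda>u. g (a + u *\<^sub>R d)) has_real_derivative c \<bullet> d) (at u)"
proof -
  have "((\<lambda>u. a + u *\<^sub>R d) has_derivative (\<lambda>h. h *\<^sub>R d)) (at u)"
    by (auto intro!: derivative_eq_intros)
  moreover have "(g has_derivative (\<lambda>h. h \<bullet> c)) (at (a + u *\<^sub>R d))"
    using assms by (simp add: gderiv_def)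
  ultimately have "((\<lambda>u. g (a + u *\<^sub>R d)) has_derivative (\<lambda>h. (h *\<^sub>R d) \<bullet> c)) (at u)"
    by (rule has_derivative_compose)
  then show ?thesis
    by (rule has_derivative_imp_has_field_derivative) (simp add: inner_commute [of c])
qed

text \<open>By convexity the difference quotients along the segment from \<open>a\<close> to
  \<open>z\<close> are at most \<open>g z - g a\<close>; their right limit at 0 is the directional
  derivative.\<close>

lemma convex_on_GDERIV_le:
  fixes g :: "'a::real_inner \<Rightarrow> real"
  assumes conv: "convex_on UNIV g" and d: "GDERIV g a :> c"
  shows "g a + c \<bullet> (z - a) \<le> g z"
proof -
  let ?\<phi> = "\<lambda>u::real. g (a + u *\<^sub>R (z - a))"
  have "(?\<phi> has_real_derivative c \<bullet> (z - a)) (at 0)"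
    by (rule GDERIV_along_line) (simp add: d)
  then have lim: "((\<lambda>u. (?\<phi> u - ?\<phi> 0) / u) \<longlongrightarrow> c \<bullet> (z - a)) (at_right 0)"
    by (auto simp: has_field_derivative_iff intro: tendsto_within_subset)
  have "eventually (\<lambda>u::real. u \<in> {0<..<1}) (at_right 0)"
    by (rule eventually_at_right_real) simp
  then have "eventually (\<lambda>u. (?\<phi> u - ?\<phi> 0) / u \<le> g z - g a) (at_right 0)"
  proof eventually_elim
    case (elim u)
    have "g ((1 - u) *\<^sub>R a + u *\<^sub>R z) \<le> (1 - u) * g a + u * g z"
      using elim by (intro convex_onD [OF conv]) auto
    moreover have "(1 - u) *\<^sub>R a + u *\<^sub>R z = a + u *\<^sub>R (z - a)"
      by (simp add: algebra_simps)
    ultimately show ?case using elim by (simp add: field_simps)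
  qed
  with lim have "c \<bullet> (z - a) \<le> g z - g a"
    by (rule tendsto_upperbound) simp
  then show ?thesis by simp
qed

lemma descent_lemma:
  fixes g :: "'a::real_inner \<Rightarrow> real"
  assumes d: "\<And>z. GDERIV g z :> G z" and lip: "L-lipschitz_on UNIV G"
  shows "g z \<le> g a + G a \<bullet> (z - a) + L / 2 * (norm (z - a))\<^sup>2"
proof -
  define w where "w = z - a"
  \<comment> \<open>\<open>\<psi>\<close> is \<open>g\<close> along the segment minus the claimed
    upper bound, up to the constant \<open>g a\<close>. Cauchy-Schwarz and the Lipschitz bound make
    its derivative nonpositive.\<close>
  define \<psi> where "\<psi> u = g (a + u *\<^sub>R w) - u * (G a \<bullet> w) - L / 2 * u\<^sup>2 * (norm w)\<^sup>2" for u
  have "\<psi> 1 \<le> \<psi> 0"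
  proof (rule DERIV_nonpos_imp_nonincreasing [of 0 1])
    fix u :: real assume u: "0 \<le> u" "u \<le> 1"
    have "(\<psi> has_real_derivative G (a + u *\<^sub>R w) \<bullet> w - G a \<bullet> w - L * u * (norm w)\<^sup>2) (at u)"
      unfolding \<psi>_def
      by (rule derivative_eq_intros GDERIV_along_line d refl | simp)+
    moreover have "G (a + u *\<^sub>R w) \<bullet> w - G a \<bullet> w \<le> L * u * (norm w)\<^sup>2"
    proof -
      have "(G (a + u *\<^sub>R w) - G a) \<bullet> w \<le> norm (G (a + u *\<^sub>R w) - G a) * norm w"
        by (rule norm_cauchy_schwarz)
      also have "\<dots> \<le> (L * norm (u *\<^sub>R w)) * norm w"
        using lipschitz_onD [OF lip, of "a + u *\<^sub>R w" a]
        by (intro mult_right_mono) (auto simp: dist_norm)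
      also have "\<dots> = L * u * (norm w)\<^sup>2"
        using u by (simp add: power2_eq_square)
      finally show ?thesis by (simp add: inner_diff_left)
    qed
    ultimately show "\<exists>y. DERIV \<psi> u :> y \<and> y \<le> 0" by force
  qed simp
  then show ?thesis by (simp add: \<psi>_def w_def)
qed

section \<open>Lower semicontinuity through closed epigraphs\<close>

text \<open>The complement of the epigraph is open: a level \<open>r'\<close> strictly between
  \<open>r\<close> and \<open>f z\<close> stays below \<open>f\<close> near \<open>z\<close>, which
  leaves room to vary both the point and the height.\<close>

lemma closed_epigraph_lsc_fun:
  fixes f :: "'a::topological_space \<Rightarrow> ereal"
  assumes "proper_fun f" and lsc: "lsc_fun f"
  shows "closed (epigraph {z. f z \<noteq> \<infinity>} (\<lambda>z. real_of_ereal (f z)))"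
proof -
  have epi: "epigraph {z. f z \<noteq> \<infinity>} (\<lambda>z. real_of_ereal (f z)) = {(z, r). f z \<le> ereal r}"
  proof -
    have "f z \<noteq> \<infinity> \<and> real_of_ereal (f z) \<le> r \<longleftrightarrow> f z \<le> ereal r" for z r
      using assms(1) by (cases "f z") (auto simp: proper_fun_def)
    then show ?thesis by (auto simp: epigraph_def)
  qed
  have "open {(z, r). ereal r < f z}"
  proof (subst open_subopen, intro ballI)
    fix p assume "p \<in> {(z, r). ereal r < f z}"
    then obtain z r where p: "p = (z, r)" "ereal r < f z" by auto
    then obtain r' where r': "r < r'" "ereal r' < f z"
      using ereal_dense2 by fastforce
    from r'(2) lsc have "ereal r' < Liminf (at z) f"
      unfolding lsc_fun_def by (metis less_le_trans)
    \<comment> \<open>The limit inferior ignores \<open>z\<close> itself, so the full neighbourhood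
      also needs \<open>ereal r' < f z\<close>.\<close>
    then have "eventually (\<lambda>w. ereal r' < f w) (nhds z)"
      using r'(2) by (auto simp: eventually_nhds_conv_at dest: less_LiminfD)
    then obtain U where U: "open U" "z \<in> U" "\<And>w. w \<in> U \<Longrightarrow> ereal r' < f w"
      by (auto simp: eventually_nhds)
    have "U \<times> {..<r'} \<subseteq> {(z, r). ereal r < f z}"
      by (auto intro!: less_trans [OF _ U(3)])
    then show "\<exists>T. open T \<and> p \<in> T \<and> T \<subseteq> {(z, r). ereal r < f z}"
      using U(1,2) r'(1) p(1) by (intro exI [of _ "U \<times> {..<r'}"]) (auto intro: open_Times)
  qed
  moreover have "- {(z, r). ereal r < f z} = {(z, r). f z \<le> ereal r}"
    by auto
  ultimately show ?thesis unfolding epi closed_def by (metis double_complement)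
qed

text \<open>The new epigraph is the preimage of the old one under the continuous shear sending
  \<open>(z, r)\<close> to \<open>(z, r - g z)\<close>.\<close>

lemma closed_epigraph_add:
  fixes h :: "'a::topological_space \<Rightarrow> real"
  assumes "closed (epigraph D h)" and "continuous_on UNIV g"
  shows "closed (epigraph D (\<lambda>z. h z + g z))"
proof -
  have "continuous_on UNIV (\<lambda>p::'a \<times> real. (fst p, snd p - g (fst p)))"
    by (intro continuous_intros continuous_on_compose2 [OF assms(2)]) auto
  then have "closed ((\<lambda>p::'a \<times> real. (fst p, snd p - g (fst p))) -` epigraph D h)"
    by (intro closed_vimage assms(1))
  moreover have "(\<lambda>p::'a \<times> real. (fst p, snd p - g (fst p))) -` epigraph D h
      = epigraph D (\<lambda>z. h z + g z)"
    by (auto simp: epigraph_def)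
  ultimately show ?thesis by simp
qed

lemma closed_epigraph_limit:
  assumes "closed (epigraph D h)" "\<And>n::nat. z n \<in> D" "\<And>n. h (z n) \<le> m n"
    and "z \<longlonglongrightarrow> p" "m \<longlonglongrightarrow> r"
  shows "p \<in> D" "h p \<le> r"
proof -
  have "(p, r) \<in> epigraph D h"
    using assms(2,3)
    by (intro closed_sequentially [OF assms(1) _ tendsto_Pair [OF assms(4,5)]])
       (auto simp: mem_epigraph)
  then show "p \<in> D" "h p \<le> r" by (auto simp: mem_epigraph)
qed

section \<open>Minimizers of strongly convex functions\<close>

text \<open>Compare \<open>p\<close> with the points of the segment towards \<open>z\<close>.
  Dividing by \<open>u\<close> leaves the gain \<open>c * (1 - u)\<close>, and \<open>u\<close>
  tending to 0 recovers the full constant \<open>c\<close>.\<close>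

lemma strong_minimizer_ineq:
  fixes h :: "'a::real_inner \<Rightarrow> real"
  assumes h: "convex_on D h" and c: "c \<ge> 0" and p: "p \<in> D" and z: "z \<in> D"
    and min: "\<And>z. z \<in> D \<Longrightarrow> h p + c * (norm (p - a))\<^sup>2 \<le> h z + c * (norm (z - a))\<^sup>2"
  shows "h p + c * (norm (p - a))\<^sup>2 + c * (norm (z - p))\<^sup>2 \<le> h z + c * (norm (z - a))\<^sup>2"
proof -
  let ?\<phi> = "\<lambda>z. h z + c * (norm (z - a))\<^sup>2"
  have "?\<phi> p + c * (1 - u) * (norm (z - p))\<^sup>2 \<le> ?\<phi> z" if u: "u \<in> {0<..<1}" for u
  proof -
    let ?w = "(1 - u) *\<^sub>R p + u *\<^sub>R z"
    have "?w \<in> D"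
      using convex_on_imp_convex [OF h] p z u by (intro convexD_alt) auto
    then have "?\<phi> p \<le> ?\<phi> ?w" by (rule min)
    also have "h ?w \<le> (1 - u) * h p + u * h z"
      using u p z by (intro convex_onD [OF h]) auto
    also have "(norm (?w - a))\<^sup>2 = (1 - u) * (norm (p - a))\<^sup>2 + u * (norm (z - a))\<^sup>2
        - u * (1 - u) * (norm (z - p))\<^sup>2"
      by (rule norm_sq_convex_combination)
    finally have "u * (?\<phi> p + c * (1 - u) * (norm (z - p))\<^sup>2) \<le> u * ?\<phi> z"
      by (simp add: algebra_simps)
    then show ?thesis using u by simp
  qed
  then have "eventually (\<lambda>u. ?\<phi> p + c * (1 - u) * (norm (z - p))\<^sup>2 \<le> ?\<phi> z) (at_right 0)"
    using eventually_at_right_real [of 0 1] by (auto elim: eventually_mono)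
  moreover have "((\<lambda>u. ?\<phi> p + c * (1 - u) * (norm (z - p))\<^sup>2) \<longlongrightarrow>
      ?\<phi> p + c * (1 - 0) * (norm (z - p))\<^sup>2) (at_right 0)"
    by (intro tendsto_intros)
  ultimately have "?\<phi> p + c * (1 - 0) * (norm (z - p))\<^sup>2 \<le> ?\<phi> z"
    by (intro tendsto_upperbound [where F = "at_right (0::real)"]) auto
  then show ?thesis by simp
qed

text \<open>The midpoint of two near-minimizers would fall below the infimum unless they are close.
  Hence a minimizing sequence is Cauchy, and the closed epigraph carries its bounds to the
  limit.\<close>

lemma strong_minimizer_exists:
  fixes h :: "'a::{real_inner,complete_space} \<Rightarrow> real"
  assumes h: "convex_on D h" "closed (epigraph D h)" "D \<noteq> {}" and c: "c > 0"
    and bdd: "\<And>z. z \<in> D \<Longrightarrow> m \<le> h z + c * (norm (z - a))\<^sup>2"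
  obtains p where "p \<in> D"
    "\<And>z. z \<in> D \<Longrightarrow>
      h p + c * (norm (p - a))\<^sup>2 + c * (norm (z - p))\<^sup>2 \<le> h z + c * (norm (z - a))\<^sup>2"
proof -
  let ?\<phi> = "\<lambda>z. h z + c * (norm (z - a))\<^sup>2"
  define I where "I = Inf (?\<phi> ` D)"
  have bb: "bdd_below (?\<phi> ` D)" using bdd by (auto intro!: bdd_belowI)
  have I: "I \<le> ?\<phi> z" if "z \<in> D" for z
    using that bb by (auto simp: I_def intro: cInf_lower)
  have "\<exists>z\<in>D. ?\<phi> z < I + inverse (real (Suc n))" for n
    using cInf_lessD [of "?\<phi> ` D" "I + inverse (real (Suc n))"] h(3) by (auto simp: I_def)
  then obtain w where w: "\<And>n. w n \<in> D" "\<And>n. ?\<phi> (w n) < I + inverse (real (Suc n))"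
    by metis
  \<comment> \<open>The constant \<open>c / 4\<close> is \<open>c * u * (1 - u)\<close> at the
    midpoint \<open>u = 1/2\<close>.\<close>
  have gap: "c / 4 * (norm (w i - w j))\<^sup>2 \<le> inverse (real (Suc n))" if "n \<le> i" "n \<le> j" for i j n
  proof -
    let ?v = "(1 - 1/2) *\<^sub>R w i + (1/2) *\<^sub>R w j"
    have "?v \<in> D"
      using convex_on_imp_convex [OF h(1)] w(1) by (intro convexD_alt) auto
    then have "I \<le> ?\<phi> ?v" by (rule I)
    also have "h ?v \<le> (1 - 1/2) * h (w i) + (1/2) * h (w j)"
      using w(1) by (intro convex_onD [OF h(1)]) auto
    also have "(norm (?v - a))\<^sup>2 = (1 - 1/2) * (norm (w i - a))\<^sup>2 + (1/2) * (norm (w j - a))\<^sup>2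
        - (1/2) * (1 - 1/2) * (norm (w j - w i))\<^sup>2"
      by (rule norm_sq_convex_combination)
    finally have *: "c / 4 * (norm (w i - w j))\<^sup>2 \<le> (?\<phi> (w i) + ?\<phi> (w j)) / 2 - I"
      by (simp add: algebra_simps norm_minus_commute [of "w j"])
    have inv: "inverse (real (Suc i)) \<le> inverse (real (Suc n))"
        "inverse (real (Suc j)) \<le> inverse (real (Suc n))"
      using that by (auto intro: le_imp_inverse_le)
    have "P \<le> \<delta>" if "P \<le> (A + B) / 2 - I" "A < I + a" "B < I + b" "a \<le> \<delta>" "b \<le> \<delta>"
      for P A B a b \<delta> :: real
      using that by argo
    from this [OF * w(2) w(2) inv] show ?thesis .
  qed
  have "Cauchy w"
  proof (rule metric_CauchyI)
    fix e :: real assume "e > 0"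
    then have "c / 4 * e\<^sup>2 > 0" using c by simp
    then obtain n where n: "inverse (real (Suc n)) < c / 4 * e\<^sup>2"
      using reals_Archimedean by blast
    show "\<exists>M. \<forall>i\<ge>M. \<forall>j\<ge>M. dist (w i) (w j) < e"
    proof (intro exI allI impI)
      fix i j assume "n \<le> i" "n \<le> j"
      from gap [OF this] n have "c / 4 * (norm (w i - w j))\<^sup>2 < c / 4 * e\<^sup>2" by simp
      then have "(norm (w i - w j))\<^sup>2 < e\<^sup>2" using c by simp
      then show "dist (w i) (w j) < e"
        using \<open>e > 0\<close> by (simp add: dist_norm power2_less_imp_less)
    qed
  qed
  then obtain p where p: "w \<longlonglongrightarrow> p" by (auto simp: Cauchy_convergent_iff convergent_def)
  have cont: "continuous_on UNIV (\<lambda>z. c * (norm (z - a))\<^sup>2)" by (intro continuous_intros)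
  have "(\<lambda>n. I + inverse (real (Suc n))) \<longlonglongrightarrow> I + 0"
    by (intro tendsto_intros LIMSEQ_inverse_real_of_nat)
  then have "(\<lambda>n. I + inverse (real (Suc n))) \<longlonglongrightarrow> I" by simp
  from closed_epigraph_limit [OF closed_epigraph_add [OF h(2) cont] w(1) less_imp_le [OF w(2)] p this]
  have "p \<in> D" "?\<phi> p \<le> I" by auto
  have "?\<phi> p \<le> ?\<phi> z" if "z \<in> D" for z
    using \<open>?\<phi> p \<le> I\<close> I [OF that] by linarith
  from strong_minimizer_ineq [OF h(1) less_imp_le [OF c] \<open>p \<in> D\<close> _ this]
  show ?thesis by (rule that [OF \<open>p \<in> D\<close>])
qed

subsection \<open>The proximal operator and the Tikhonov path\<close>

text \<open>A proper function is traded for a real-valued one on its effective domain, so that the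
  estimates can be carried out in real arithmetic.\<close>

abbreviation edom :: "('a \<Rightarrow> ereal) \<Rightarrow> 'a set" where
  "edom f \<equiv> {z. f z \<noteq> \<infinity>}"

abbreviation rval :: "('a \<Rightarrow> ereal) \<Rightarrow> 'a \<Rightarrow> real" where
  "rval f \<equiv> \<lambda>z. real_of_ereal (f z)"

lemma proper_fun_eq_rval: "proper_fun f \<Longrightarrow> z \<in> edom f \<Longrightarrow> f z = ereal (rval f z)"
  by (cases "f z") (auto simp: proper_fun_def)

lemma convex_on_rval:
  assumes "proper_fun f" "convex_fun f"
  shows "convex_on (edom f) (rval f)"
proof -
  have *: "u *\<^sub>R a + v *\<^sub>R b \<in> edom f \<and>
      rval f (u *\<^sub>R a + v *\<^sub>R b) \<le> u * rval f a + v * rval f b"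
    if "a \<in> edom f" "b \<in> edom f" "0 \<le> u" "0 \<le> v" "u + v = 1" for a b u v
  proof -
    have "f (u *\<^sub>R a + v *\<^sub>R b) \<le> ereal u * f a + ereal v * f b"
      using assms(2) that unfolding convex_fun_def by blast
    also have "\<dots> = ereal (u * rval f a + v * rval f b)"
      by (subst (1 2) proper_fun_eq_rval [OF assms(1)]) (use that in auto)
    finally show ?thesis
      using assms(1) unfolding proper_fun_def by (cases "f (u *\<^sub>R a + v *\<^sub>R b)") auto
  qed
  then show ?thesis unfolding convex_on_def convex_def by blast
qed

text \<open>Properness supplies a point of finite value, so no point outside the effective domain
  can be a minimizer, nor can it beat one.\<close>

lemma is_arg_min_ereal_add:
  assumes "proper_fun f"
  shows "is_arg_min (\<lambda>z. f z + ereal (q z)) (\<lambda>_. True) p \<longleftrightarrow>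
    p \<in> edom f \<and> (\<forall>z\<in>edom f. rval f p + q p \<le> rval f z + q z)"
proof (cases "p \<in> edom f")
  case True
  then have p: "f p = ereal (rval f p)" by (rule proper_fun_eq_rval [OF assms])
  have "\<not> f z + ereal (q z) < f p + ereal (q p) \<longleftrightarrow>
      (z \<in> edom f \<longrightarrow> rval f p + q p \<le> rval f z + q z)" for z
    using assms p by (cases "f z"; cases "f p") (auto simp: proper_fun_def)
  then show ?thesis using True by (auto simp: is_arg_min_def)
next
  case False
  obtain z where "f z \<noteq> \<infinity>" using assms by (auto simp: proper_fun_def)
  then have "f z + ereal (q z) < f p + ereal (q p)" using False by simp
  then show ?thesis using False by (auto simp: is_arg_min_def)
qed

lemma argmin_set_ereal_add:
  assumes "proper_fun f"
  shows "argmin_set (\<lambda>z. f z + ereal (q z)) =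
    {p \<in> edom f. \<forall>z\<in>edom f. rval f p + q p \<le> rval f z + q z}"
  unfolding argmin_set_def is_arg_min_ereal_add [OF assms] by auto

lemma mem_subdifferentialI:
  assumes "proper_fun f" "p \<in> edom f"
    and "\<And>z. z \<in> edom f \<Longrightarrow> rval f p + v \<bullet> (z - p) \<le> rval f z"
  shows "v \<in> subdifferential f p"
proof -
  note p = proper_fun_eq_rval [OF assms(1,2)]
  have "f p + ereal (v \<bullet> (z - p)) \<le> f z" for z
  proof (cases "z \<in> edom f")
    case True
    then show ?thesis
      using assms(3) [OF True] by (subst p, subst proper_fun_eq_rval [OF assms(1) True]) simp
  qed simp
  moreover have "\<bar>f p\<bar> \<noteq> \<infinity>" by (subst p) simp
  ultimately show ?thesis by (simp add: subdifferential_def)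
qed

section \<open>The proximal gradient step\<close>

text \<open>The residual \<open>(w - prox s f w) /\<^sub>R s\<close> is a subgradient of
  \<open>f\<close> at the proximal point: in the strong minimizer inequality the three squared norms
  combine into an inner product. The bound \<open>bdd\<close> makes the infimum finite and so gives
  existence.\<close>

lemma prox_variational:
  fixes f :: "'a::{real_inner,complete_space} \<Rightarrow> ereal"
  assumes f: "proper_fun f" "convex_fun f" "lsc_fun f" and s: "s > 0"
    and bdd: "\<And>z. z \<in> edom f \<Longrightarrow> m \<le> rval f z + 1 / (2 * s) * (norm (z - w))\<^sup>2"
  shows "prox s f w \<in> edom f"
    and "z \<in> edom f \<Longrightarrow>
      rval f (prox s f w) + ((w - prox s f w) /\<^sub>R s) \<bullet> (z - prox s f w) \<le> rval f z"
proof -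
  let ?p = "prox s f w"
  let ?P = "is_arg_min (\<lambda>z. f z + ereal (1 / (2 * s) * (norm (z - w))\<^sup>2)) (\<lambda>_. True)"
  have c: "1 / (2 * s) > 0" using s by simp
  have ne: "edom f \<noteq> {}" using f(1) by (auto simp: proper_fun_def)
  obtain p where p: "p \<in> edom f" "\<And>z. z \<in> edom f \<Longrightarrow>
      rval f p + 1 / (2 * s) * (norm (p - w))\<^sup>2 + 1 / (2 * s) * (norm (z - p))\<^sup>2
        \<le> rval f z + 1 / (2 * s) * (norm (z - w))\<^sup>2"
    using strong_minimizer_exists
      [OF convex_on_rval [OF f(1,2)] closed_epigraph_lsc_fun [OF f(1,3)] ne c bdd] by metis
  have "?P p"
    unfolding is_arg_min_ereal_add [OF f(1)]
  proof (intro conjI ballI)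
    fix z assume "z \<in> edom f"
    from p(2) [OF this] show "rval f p + 1 / (2 * s) * (norm (p - w))\<^sup>2
        \<le> rval f z + 1 / (2 * s) * (norm (z - w))\<^sup>2"
      using s by (elim order.trans [rotated]) simp
  qed (rule p(1))
  \<comment> \<open>Any minimizer justifies the choice made by \<open>arg_min\<close>, so uniqueness
    does not enter.\<close>
  then have "?P ?p"
    unfolding prox_def arg_min_def by (rule someI)
  then have p: "?p \<in> edom f" and min: "\<And>z. z \<in> edom f \<Longrightarrow>
      rval f ?p + 1 / (2 * s) * (norm (?p - w))\<^sup>2 \<le> rval f z + 1 / (2 * s) * (norm (z - w))\<^sup>2"
    unfolding is_arg_min_ereal_add [OF f(1)] by auto
  show "?p \<in> edom f" by (rule p)
  assume z: "z \<in> edom f"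
  have "rval f ?p + 1 / (2 * s) * (norm (?p - w))\<^sup>2 + 1 / (2 * s) * (norm (z - ?p))\<^sup>2
      \<le> rval f z + 1 / (2 * s) * (norm (z - w))\<^sup>2"
    using c by (intro strong_minimizer_ineq [OF convex_on_rval [OF f(1,2)] _ p z min]) auto
  moreover have "(norm (?p - w))\<^sup>2 + (norm (z - ?p))\<^sup>2 - (norm (z - w))\<^sup>2
      = 2 * ((w - ?p) \<bullet> (z - ?p))"
    unfolding power2_norm_eq_inner
    by (simp add: inner_diff inner_commute [of ?p z] inner_commute [of ?p w] inner_commute [of z w] algebra_simps)
  then have "1 / (2 * s) * (norm (?p - w))\<^sup>2 + 1 / (2 * s) * (norm (z - ?p))\<^sup>2
      - 1 / (2 * s) * (norm (z - w))\<^sup>2 = ((w - ?p) /\<^sub>R s) \<bullet> (z - ?p)"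
    unfolding inner_scaleR_left using s by (simp add: field_simps)
  ultimately show "rval f ?p + ((w - ?p) /\<^sub>R s) \<bullet> (z - ?p) \<le> rval f z"
    by linarith
qed

text \<open>\<open>G y + e *\<^sub>R y\<close> is the gradient at \<open>y\<close> of
  \<open>g\<close> plus the quadratic penalty. Bound this sum below at \<open>z\<close> by convexity
  and above at \<open>p\<close> by the descent lemma, then add the subgradient inequality for
  \<open>h\<close>. The condition \<open>s * (L + e) \<le> 1\<close> absorbs the remaining multiple
  of \<open>(norm (p - y))\<^sup>2\<close>.\<close>

lemma proximal_gradient_ineq:
  fixes g h :: "'a::real_inner \<Rightarrow> real"
  assumes g: "convex_on UNIV g" "\<And>z. GDERIV g z :> G z" "L-lipschitz_on UNIV G"
    and s: "0 < s" and e: "0 \<le> e" "s * (L + e) \<le> 1"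
    and sub: "h p + ((y - s *\<^sub>R G y - (s * e) *\<^sub>R y - p) /\<^sub>R s) \<bullet> (z - p) \<le> h z"
  shows "h p + g p + e / 2 * (norm p)\<^sup>2 + 1 / (2 * s) * (norm (z - p))\<^sup>2
    \<le> h z + g z + e / 2 * (norm z)\<^sup>2 + 1 / (2 * s) * (norm (z - y))\<^sup>2"
proof -
  have 1: "g y + G y \<bullet> (z - y) \<le> g z" by (rule convex_on_GDERIV_le) (use g in auto)
  have 2: "g p \<le> g y + G y \<bullet> (p - y) + L / 2 * (norm (p - y))\<^sup>2"
    by (rule descent_lemma) (use g in auto)
  have sq: "e / 2 * (norm w)\<^sup>2 = e / 2 * (norm y)\<^sup>2 + e * (y \<bullet> (w - y)) + e / 2 * (norm (w - y))\<^sup>2"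
    for w
    unfolding power2_norm_eq_inner by (simp add: inner_diff inner_commute [of w y] algebra_simps)
  have "((y - s *\<^sub>R G y - (s * e) *\<^sub>R y - p) /\<^sub>R s) \<bullet> (z - p)
      = 1 / s * ((y - p) \<bullet> (z - p)) - G y \<bullet> (z - p) - e * (y \<bullet> (z - p))"
    unfolding inner_scaleR_left inner_diff_left using s by (simp add: field_simps)
  also have "(y - p) \<bullet> (z - p) = ((norm (p - y))\<^sup>2 + (norm (z - p))\<^sup>2 - (norm (z - y))\<^sup>2) / 2"
    unfolding power2_norm_eq_inner
    by (simp add: inner_diff inner_commute [of p z] inner_commute [of p y] inner_commute [of z y] algebra_simps)
  finally have 3: "h p + (1 / (2 * s) * (norm (p - y))\<^sup>2 + 1 / (2 * s) * (norm (z - p))\<^sup>2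
      - 1 / (2 * s) * (norm (z - y))\<^sup>2) - G y \<bullet> (z - p) - e * (y \<bullet> (z - p)) \<le> h z"
    using sub by (simp add: diff_divide_distrib add_divide_distrib right_diff_distrib distrib_left)
  have 4: "(L / 2 + e / 2) * (norm (p - y))\<^sup>2 \<le> 1 / (2 * s) * (norm (p - y))\<^sup>2"
    using e(2) s by (intro mult_right_mono) (auto simp: field_simps)
  have 5: "G y \<bullet> (z - p) = G y \<bullet> (z - y) - G y \<bullet> (p - y)"
      "y \<bullet> (z - p) = y \<bullet> (z - y) - y \<bullet> (p - y)"
    by (simp_all add: inner_diff)
  have 6: "0 \<le> e / 2 * (norm (z - y))\<^sup>2" using e by simp
  show ?thesis
    using 1 2 3 4 6 sq [of p] sq [of z] unfolding 5 by (simp add: algebra_simps)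
qed

text \<open>Makes the proximal problem bounded below whenever \<open>f + g\<close> is. The descent
  lemma bounds \<open>g\<close> above by a quadratic of curvature \<open>L\<close>; since
  \<open>1 / s\<close> exceeds \<open>L\<close>, a positive quadratic remains, and completing the
  square yields the constant.\<close>

lemma prox_objective_bounded_below:
  fixes g :: "'a::real_inner \<Rightarrow> real"
  assumes g: "\<And>z. GDERIV g z :> G z" "L-lipschitz_on UNIV G" and s: "0 < s" "s * L < 1"
    and min: "M \<le> h + g z"
  shows "M - g w - (norm (G w))\<^sup>2 / (4 * (1 / (2 * s) - L / 2)) \<le> h + 1 / (2 * s) * (norm (z - w))\<^sup>2"
proof -
  define a where "a = 1 / (2 * s) - L / 2"
  have a: "a > 0" using s by (simp add: a_def field_simps)
  let ?r = "norm (z - w)" and ?b = "norm (G w)"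
  have "g z \<le> g w + G w \<bullet> (z - w) + L / 2 * ?r\<^sup>2"
    by (rule descent_lemma) (use g in auto)
  also have "G w \<bullet> (z - w) \<le> ?b * ?r" by (rule norm_cauchy_schwarz)
  finally have 1: "M - g w - ?b * ?r - L / 2 * ?r\<^sup>2 \<le> h" using min by linarith
  have "0 \<le> a * (?r - ?b / (2 * a))\<^sup>2" using a by simp
  also have "\<dots> = a * ?r\<^sup>2 - ?b * ?r + ?b\<^sup>2 / (4 * a)"
    using a by (simp add: power2_diff field_simps) (simp add: power2_eq_square)
  finally have "- (?b\<^sup>2 / (4 * a)) \<le> a * ?r\<^sup>2 - ?b * ?r" by linarith
  moreover have "a * ?r\<^sup>2 = 1 / (2 * s) * ?r\<^sup>2 - L / 2 * ?r\<^sup>2"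
    by (simp add: a_def left_diff_distrib)
  ultimately show ?thesis using 1 unfolding a_def [symmetric] by linarith
qed

text \<open>No weak compactness is needed: the path satisfies \<open>\<parallel>xb l - xb k\<parallel>\<^sup>2 \<le> \<parallel>xb l\<parallel>\<^sup>2 - \<parallel>xb k\<parallel>\<^sup>2\<close> for
  \<open>k \<le> l\<close>, and its norms are bounded, so it is a Cauchy sequence.\<close>

lemma tikhonov_path_tendsto:
  fixes h :: "'a::{real_inner,complete_space} \<Rightarrow> real"
  assumes epi: "closed (epigraph D h)"
    and q0: "q0 \<in> D" "\<And>z. z \<in> D \<Longrightarrow> h q0 \<le> h z"
    and pos: "\<And>k. k \<ge> 1 \<Longrightarrow> \<epsilon> k > 0" and anti: "antimono_on {1..} \<epsilon>" and lim: "\<epsilon> \<longlonglongrightarrow> 0"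
    and xb: "\<And>k. k \<ge> 1 \<Longrightarrow> xb k \<in> D"
    and min: "\<And>k z. k \<ge> 1 \<Longrightarrow> z \<in> D \<Longrightarrow>
      h (xb k) + \<epsilon> k / 2 * (norm (xb k))\<^sup>2 + \<epsilon> k / 2 * (norm (z - xb k))\<^sup>2
        \<le> h z + \<epsilon> k / 2 * (norm z)\<^sup>2"
  obtains q where "q \<in> D" "\<And>z. z \<in> D \<Longrightarrow> h q \<le> h z" "xb \<longlonglongrightarrow> q"
    "\<And>z. z \<in> D \<Longrightarrow> h z \<le> h q \<Longrightarrow> (norm (z - q))\<^sup>2 + (norm q)\<^sup>2 \<le> (norm z)\<^sup>2"
proof -
  have below: "(norm (z - xb k))\<^sup>2 + (norm (xb k))\<^sup>2 \<le> (norm z)\<^sup>2"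
    if "k \<ge> 1" "z \<in> D" "\<And>w. w \<in> D \<Longrightarrow> h z \<le> h w" for k z
  proof -
    have "\<epsilon> k / 2 * ((norm (z - xb k))\<^sup>2 + (norm (xb k))\<^sup>2) \<le> \<epsilon> k / 2 * (norm z)\<^sup>2"
      using min [OF that(1,2)] that(3) [OF xb [OF that(1)]] unfolding distrib_left by linarith
    then show ?thesis using pos [OF that(1)] by simp
  qed
  \<comment> \<open>Test the inequality of index \<open>k\<close> at \<open>xb l\<close> and that of
    index \<open>l\<close> at \<open>xb k\<close>. In the sum the values of \<open>h\<close> cancel.
    Equal parameters are treated apart, since otherwise one divides by
    \<open>\<epsilon> k - \<epsilon> l\<close>.\<close>
  have mono: "(norm (xb l - xb k))\<^sup>2 \<le> (norm (xb l))\<^sup>2 - (norm (xb k))\<^sup>2" if "1 \<le> k" "k \<le> l" for k l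
  proof (cases "\<epsilon> l = \<epsilon> k")
    case True
    have "\<epsilon> k * (norm (xb l - xb k))\<^sup>2 \<le> 0"
      using min [of k "xb l"] min [of l "xb k"] that xb True
      by (simp add: norm_minus_commute [of "xb k"])
    then have "xb l = xb k"
      using pos [OF that(1)] by (auto simp: mult_le_0_iff)
    then show ?thesis by simp
  next
    case False
    then have lt: "\<epsilon> l < \<epsilon> k"
      using anti that by (auto simp: monotone_on_def order_less_le)
    have el: "\<epsilon> l > 0" using pos that by simp
    let ?N = "(norm (xb l))\<^sup>2 - (norm (xb k))\<^sup>2" and ?d = "(norm (xb l - xb k))\<^sup>2"
    have "(\<epsilon> k + \<epsilon> l) * ?d \<le> (\<epsilon> k - \<epsilon> l) * ?N"
      using min [of k "xb l"] min [of l "xb k"] that xb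
      by (simp add: norm_minus_commute [of "xb k"] algebra_simps)
    moreover have "(\<epsilon> k - \<epsilon> l) * ?d \<le> (\<epsilon> k + \<epsilon> l) * ?d"
      using el by (intro mult_right_mono) auto
    ultimately have "(\<epsilon> k - \<epsilon> l) * ?d \<le> (\<epsilon> k - \<epsilon> l) * ?N" by linarith
    then show ?thesis using lt by simp
  qed
  \<comment> \<open>The shift by one is needed because the hypotheses on \<open>\<epsilon>\<close>
    and \<open>xb\<close> start at index 1.\<close>
  define N where "N k = (norm (xb (Suc k)))\<^sup>2" for k
  have "incseq N"
  proof (rule monoI)
    fix k l :: nat assume "k \<le> l"
    then have "0 \<le> N l - N k"
      unfolding N_def by (intro order.trans [OF zero_le_power2 mono]) auto
    then show "N k \<le> N l" by simp
  qed
  moreover have "N k \<le> (norm q0)\<^sup>2" for k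
  proof -
    have "(norm (q0 - xb (Suc k)))\<^sup>2 + (norm (xb (Suc k)))\<^sup>2 \<le> (norm q0)\<^sup>2"
      by (rule below) (use q0 in auto)
    then show ?thesis
      unfolding N_def using zero_le_power2 [of "norm (q0 - xb (Suc k))"] by linarith
  qed
  ultimately have "convergent N"
    by (meson incseq_convergent convergentI)
  then have cN: "Cauchy N" by (rule convergent_Cauchy)
  have "Cauchy (\<lambda>k. xb (Suc k))"
  proof (rule metric_CauchyI)
    fix e :: real assume e: "e > 0"
    obtain M where M: "\<And>k l. k \<ge> M \<Longrightarrow> l \<ge> M \<Longrightarrow> dist (N k) (N l) < e\<^sup>2"
      using metric_CauchyD [OF cN, of "e\<^sup>2"] e by auto
    have *: "dist (xb (Suc k)) (xb (Suc l)) < e" if "M \<le> k" "k \<le> l" for k l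
    proof -
      have "(norm (xb (Suc l) - xb (Suc k)))\<^sup>2 \<le> N l - N k"
        using mono [of "Suc k" "Suc l"] that by (simp add: N_def)
      also have "\<dots> < e\<^sup>2" using M [of k l] that by (simp add: dist_real_def)
      finally show ?thesis
        using e by (simp add: dist_norm norm_minus_commute power2_less_imp_less)
    qed
    show "\<exists>M. \<forall>k\<ge>M. \<forall>l\<ge>M. dist (xb (Suc k)) (xb (Suc l)) < e"
      using * by (metis dist_commute nle_le)
  qed
  then obtain q where q: "(\<lambda>k. xb (Suc k)) \<longlonglongrightarrow> q"
    by (auto simp: Cauchy_convergent_iff convergent_def)
  then have xbq: "xb \<longlonglongrightarrow> q" by (rule LIMSEQ_imp_Suc)
  \<comment> \<open>Testing against \<open>q0\<close> bounds \<open>h\<close> along the path by its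
    minimum plus a vanishing term, so the limit \<open>q\<close> is a minimizer.\<close>
  have hb: "h (xb (Suc k)) \<le> h q0 + \<epsilon> (Suc k) / 2 * (norm q0)\<^sup>2" for k
  proof -
    have "0 \<le> \<epsilon> (Suc k) / 2 * a\<^sup>2" for a using pos [of "Suc k"] by simp
    from this [of "norm (xb (Suc k))"] this [of "norm (q0 - xb (Suc k))"] min [of "Suc k" q0] q0(1)
    show ?thesis by simp
  qed
  have hl: "(\<lambda>k. h q0 + \<epsilon> (Suc k) / 2 * (norm q0)\<^sup>2) \<longlonglongrightarrow> h q0 + 0 / 2 * (norm q0)\<^sup>2"
    by (intro tendsto_intros LIMSEQ_Suc [OF lim]) simp
  note q' = closed_epigraph_limit [OF epi xb hb q hl, simplified]
  then have qmin: "h q \<le> h z" if "z \<in> D" for z using q0(2) [OF that] by simp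
  show ?thesis
  proof (rule that [OF q'(1) qmin xbq])
    fix z assume z: "z \<in> D" "h z \<le> h q"
    have "(\<lambda>k. (norm (z - xb k))\<^sup>2 + (norm (xb k))\<^sup>2) \<longlonglongrightarrow> (norm (z - q))\<^sup>2 + (norm q)\<^sup>2"
      by (intro tendsto_intros xbq)
    moreover have "eventually (\<lambda>k. (norm (z - xb k))\<^sup>2 + (norm (xb k))\<^sup>2 \<le> (norm z)\<^sup>2) sequentially"
      using eventually_ge_at_top [of 1]
      by eventually_elim (rule below [OF _ z(1) order.trans [OF z(2) qmin]])
    ultimately show "(norm (z - q))\<^sup>2 + (norm q)\<^sup>2 \<le> (norm z)\<^sup>2"
      by (rule tendsto_upperbound) simp
  qed
qed

subsection \<open>Energy decay\<close>

text \<open>As \<open>S\<close> is nondecreasing, \<open>M + \<eta> / 2 * S k\<close> is a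
  supersolution of the recursion with forcing constant \<open>\<eta> / 2\<close>. Since
  \<open>S\<close> diverges, the other half of \<open>\<eta> * S k\<close> eventually absorbs
  \<open>M\<close>.\<close>

lemma damped_recursion_bound:
  fixes E \<gamma> S :: "nat \<Rightarrow> real"
  assumes S: "mono_on {N..} S" "filterlim S at_top sequentially"
    and \<gamma>: "eventually (\<lambda>k. 0 \<le> \<gamma> k \<and> \<gamma> k \<le> 1) sequentially"
    and rec: "\<And>\<eta>. \<eta> > 0 \<Longrightarrow>
      eventually (\<lambda>k. E (Suc k) \<le> (1 - \<gamma> k) * E k + \<gamma> k * (\<eta> * S k)) sequentially"
    and \<eta>: "\<eta> > 0"
  shows "eventually (\<lambda>k. E k \<le> \<eta> * S k) sequentially"
proof -
  have "eventually (\<lambda>k. N \<le> k \<and> (0 \<le> \<gamma> k \<and> \<gamma> k \<le> 1) \<and> 0 \<le> S k \<and>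
      E (Suc k) \<le> (1 - \<gamma> k) * E k + \<gamma> k * (\<eta> / 2 * S k)) sequentially"
    using \<eta> S(2) by (intro eventually_conj eventually_ge_at_top \<gamma> rec) (simp_all add: filterlim_at_top)
  then obtain K where K: "\<And>k. k \<ge> K \<Longrightarrow> N \<le> k \<and> (0 \<le> \<gamma> k \<and> \<gamma> k \<le> 1) \<and> 0 \<le> S k \<and>
      E (Suc k) \<le> (1 - \<gamma> k) * E k + \<gamma> k * (\<eta> / 2 * S k)"
    by (auto simp: eventually_at_top_linorder)
  define M where "M = max (E K) 0"
  have bound: "E k \<le> M + \<eta> / 2 * S k" if "K \<le> k" for k
    using that
  proof (induction k rule: dec_induct)
    case base
    have "0 \<le> \<eta> / 2 * S K" using K [of K] \<eta> by simp
    then show ?case by (simp add: M_def)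
  next
    case (step k)
    note k = K [OF step(1)]
    have "E (Suc k) \<le> (1 - \<gamma> k) * E k + \<gamma> k * (\<eta> / 2 * S k)" using k by blast
    also have "\<dots> \<le> (1 - \<gamma> k) * (M + \<eta> / 2 * S k) + \<gamma> k * (\<eta> / 2 * S k)"
      using step.IH k by (intro add_right_mono mult_left_mono) auto
    also have "\<dots> = M - \<gamma> k * M + \<eta> / 2 * S k"
      by (simp add: field_simps)
    also have "\<dots> \<le> M + \<eta> / 2 * S (Suc k)"
    proof -
      have "S k \<le> S (Suc k)" using k by (intro mono_onD [OF S(1)]) auto
      then have "\<eta> / 2 * S k \<le> \<eta> / 2 * S (Suc k)" using \<eta> by simp
      moreover have "0 \<le> \<gamma> k * M" using k by (simp add: M_def)
      ultimately show ?thesis by simp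
    qed
    finally show ?case .
  qed
  have "eventually (\<lambda>k. 2 * M / \<eta> \<le> S k) sequentially"
    using S(2) by (auto simp: filterlim_at_top)
  then show ?thesis using eventually_ge_at_top [of K]
  proof eventually_elim
    case (elim k)
    then show ?case using bound [of k] \<eta> by (simp add: field_simps)
  qed
qed

text \<open>With the test point \<open>w = (1 - 1/T) x + q/T\<close>, scaling by \<open>T\<close>
  turns \<open>w - x'\<close> and \<open>w - y\<close> into the new and the damped old auxiliary
  points relative to \<open>q\<close>, up to sign. The identity for
  \<open>(1 - \<gamma>) * T'\<^sup>2\<close> matches the weight \<open>T\<^sup>2 - T\<close> that
  convexity puts on the old value.\<close>

lemma energy_step:
  fixes h :: "'a::real_inner \<Rightarrow> real"
  defines "\<Phi> \<equiv> \<lambda>e z. h z + e / 2 * (norm z)\<^sup>2"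
  assumes h: "convex_on D h" and s: "0 < s" and e: "0 \<le> e" "e' \<le> e"
    and T: "1 \<le> T" and \<gamma>: "0 \<le> \<gamma>" "\<gamma> \<le> 1" "(1 - \<gamma>) * T'\<^sup>2 = T\<^sup>2 - T"
    and D: "x \<in> D" "q \<in> D"
    and y: "T *\<^sub>R y = (T - 1) *\<^sub>R x + (1 - \<gamma>) *\<^sub>R z"
    and step: "\<And>w. w \<in> D \<Longrightarrow>
      \<Phi> e x' + 1 / (2 * s) * (norm (w - x'))\<^sup>2 \<le> \<Phi> e w + 1 / (2 * s) * (norm (w - y))\<^sup>2"
  shows "T\<^sup>2 * (\<Phi> e' x' - \<Phi> e' q) + 1 / (2 * s) * (norm (x + T *\<^sub>R (x' - x) - q))\<^sup>2
    \<le> (1 - \<gamma>) * (T'\<^sup>2 * (\<Phi> e x - \<Phi> e q) + 1 / (2 * s) * (norm (z - q))\<^sup>2)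
      + \<gamma> / (2 * s) * (norm q)\<^sup>2 + T\<^sup>2 * (e - e') / 2 * (norm q)\<^sup>2"
proof -
  define u where "u = 1 / T"
  have u: "0 \<le> u" "u \<le> 1" using T by (auto simp: u_def)
  have Tu: "T * u = 1" using T by (simp add: u_def)
  define w where "w = (1 - u) *\<^sub>R x + u *\<^sub>R q"
  have "w \<in> D"
    unfolding w_def using convex_on_imp_convex [OF h] D u by (intro convexD_alt) auto
  have Tw: "T *\<^sub>R w = (T - 1) *\<^sub>R x + q"
    unfolding w_def by (simp add: algebra_simps Tu)
  have "h w \<le> (1 - u) * h x + u * h q"
    unfolding w_def using D u by (intro convex_onD [OF h]) auto
  moreover have "e / 2 * (norm w)\<^sup>2 \<le> e / 2 * ((1 - u) * (norm x)\<^sup>2 + u * (norm q)\<^sup>2)"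
  proof -
    have "0 \<le> u * (1 - u) * (norm (q - x))\<^sup>2" using u by simp
    then have "(norm w)\<^sup>2 \<le> (1 - u) * (norm x)\<^sup>2 + u * (norm q)\<^sup>2"
      using norm_sq_convex_combination [of u x q 0] by (simp add: w_def)
    then show ?thesis using e(1) by (intro mult_left_mono) auto
  qed
  ultimately have "\<Phi> e w \<le> (1 - u) * \<Phi> e x + u * \<Phi> e q"
    unfolding \<Phi>_def by (simp add: algebra_simps diff_divide_distrib)
  then have "T\<^sup>2 * \<Phi> e w \<le> T\<^sup>2 * ((1 - u) * \<Phi> e x + u * \<Phi> e q)"
    by (intro mult_left_mono) auto
  also have "\<dots> = (T\<^sup>2 - T) * \<Phi> e x + T * \<Phi> e q"
    using T by (simp add: u_def field_simps power2_eq_square)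
  finally have conv: "T\<^sup>2 * \<Phi> e w \<le> (T\<^sup>2 - T) * \<Phi> e x + T * \<Phi> e q" .
  have sq: "T\<^sup>2 * (norm v)\<^sup>2 = (norm (T *\<^sub>R v))\<^sup>2" for v :: 'a
    by (simp add: power_mult_distrib)
  have "T *\<^sub>R (w - x') = - (x + T *\<^sub>R (x' - x) - q)"
    using Tw by (simp add: algebra_simps)
  then have 1: "T\<^sup>2 * (norm (w - x'))\<^sup>2 = (norm (x + T *\<^sub>R (x' - x) - q))\<^sup>2"
    unfolding sq by (simp only: norm_minus_cancel)
  \<comment> \<open>The damped point is written as a convex combination of \<open>z\<close> and 0;
    the share of 0 produces the error \<open>\<gamma> * (norm q)\<^sup>2\<close>.\<close>
  have "T *\<^sub>R (w - y) = - ((1 - \<gamma>) *\<^sub>R z + \<gamma> *\<^sub>R 0 - q)"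
    using Tw y by (simp add: scaleR_diff_right)
  then have "T\<^sup>2 * (norm (w - y))\<^sup>2 = (norm ((1 - \<gamma>) *\<^sub>R z + \<gamma> *\<^sub>R 0 - q))\<^sup>2"
    unfolding sq by (simp only: norm_minus_cancel)
  also have "\<dots> \<le> (1 - \<gamma>) * (norm (z - q))\<^sup>2 + \<gamma> * (norm q)\<^sup>2"
    using \<gamma> unfolding norm_sq_convex_combination by simp
  finally have 2: "T\<^sup>2 * (norm (w - y))\<^sup>2 \<le> (1 - \<gamma>) * (norm (z - q))\<^sup>2 + \<gamma> * (norm q)\<^sup>2" .
  have "T\<^sup>2 * (\<Phi> e x' + 1 / (2 * s) * (norm (w - x'))\<^sup>2)
      \<le> T\<^sup>2 * (\<Phi> e w + 1 / (2 * s) * (norm (w - y))\<^sup>2)"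
    using step [OF \<open>w \<in> D\<close>] by (intro mult_left_mono) auto
  then have 3: "T\<^sup>2 * \<Phi> e x' + 1 / (2 * s) * (T\<^sup>2 * (norm (w - x'))\<^sup>2)
      \<le> T\<^sup>2 * \<Phi> e w + 1 / (2 * s) * (T\<^sup>2 * (norm (w - y))\<^sup>2)"
    by (simp add: distrib_left mult.left_commute)
  have 4: "1 / (2 * s) * (T\<^sup>2 * (norm (w - y))\<^sup>2)
      \<le> 1 / (2 * s) * ((1 - \<gamma>) * (norm (z - q))\<^sup>2 + \<gamma> * (norm q)\<^sup>2)"
    using s 2 by (intro mult_left_mono) auto
  \<comment> \<open>Lowering the penalty from \<open>e\<close> to \<open>e'\<close> helps at
    \<open>x'\<close> and costs only the term at \<open>q\<close>.\<close>
  have 5: "T\<^sup>2 * (\<Phi> e' x' - \<Phi> e' q) \<le> T\<^sup>2 * (\<Phi> e x' - \<Phi> e q) + T\<^sup>2 * (e - e') / 2 * (norm q)\<^sup>2"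
  proof -
    have "0 \<le> T\<^sup>2 * ((e - e') / 2 * (norm x')\<^sup>2)" using e by simp
    then show ?thesis unfolding \<Phi>_def by (simp add: algebra_simps diff_divide_distrib)
  qed
  have 6: "(1 - \<gamma>) * (T'\<^sup>2 * (\<Phi> e x - \<Phi> e q) + 1 / (2 * s) * (norm (z - q))\<^sup>2)
      = (T\<^sup>2 - T) * (\<Phi> e x - \<Phi> e q) + 1 / (2 * s) * ((1 - \<gamma>) * (norm (z - q))\<^sup>2)"
    using \<gamma>(3) by (simp only: distrib_left mult.assoc [symmetric]) (simp add: mult.commute)
  have 7: "1 / (2 * s) * ((1 - \<gamma>) * (norm (z - q))\<^sup>2 + \<gamma> * (norm q)\<^sup>2)
      = 1 / (2 * s) * ((1 - \<gamma>) * (norm (z - q))\<^sup>2) + \<gamma> / (2 * s) * (norm q)\<^sup>2"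
    by (simp add: distrib_left)
  have 8: "(T\<^sup>2 - T) * (\<Phi> e x - \<Phi> e q)
      = (T\<^sup>2 - T) * \<Phi> e x + T * \<Phi> e q - T\<^sup>2 * \<Phi> e q"
      "T\<^sup>2 * (\<Phi> e x' - \<Phi> e q) = T\<^sup>2 * \<Phi> e x' - T\<^sup>2 * \<Phi> e q"
    by (simp_all add: algebra_simps)
  show ?thesis
    using conv 3 4 5 unfolding 1 6 7 8 by linarith
qed

lemma cmult_smallo: "b \<in> o(g) \<Longrightarrow> (\<lambda>k. C * b k :: real) \<in> o(g :: nat \<Rightarrow> real)"
  by (cases "C = 0") simp_all

text \<open>The data of the decay argument in real-valued form: \<open>h\<close> on \<open>D\<close>
  stands for \<open>f + g\<close>, \<open>step\<close> for the proximal gradient inequality,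
  \<open>xb\<close> for the Tikhonov path, and \<open>m\<close> for a positive number below the
  limit inferior in the hypothesis on \<open>t\<close>.\<close>

locale inertial_tikhonov =
  fixes h :: "'a::{real_inner,complete_space} \<Rightarrow> real" and D :: "'a set"
    and s :: real and t \<epsilon> :: "nat \<Rightarrow> real" and x y xb :: "nat \<Rightarrow> 'a" and q :: 'a
    and k\<^sub>1 :: nat and m :: real and \<Phi> :: "nat \<Rightarrow> 'a \<Rightarrow> real"
  defines "\<Phi> \<equiv> \<lambda>k z. h z + \<epsilon> k / 2 * (norm z)\<^sup>2"
  assumes h: "convex_on D h" and s: "0 < s"
    and t0: "t 0 = 1"
    and t: "\<And>k. k \<ge> 1 \<Longrightarrow>
      t (k - 1) < t k \<and> t k < (1 + sqrt (1 + 4 * (t (k - 1))\<^sup>2)) / 2"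
    and \<epsilon>: "\<And>k. k \<ge> 1 \<Longrightarrow> \<epsilon> k > 0" "antimono_on {1..} \<epsilon>" "\<epsilon> \<longlonglongrightarrow> 0"
    and y: "\<And>k. k \<ge> 1 \<Longrightarrow> y k =
      x k + ((t k - 1) * (t (k - 1) - 1) / (t (k - 1))\<^sup>2) *\<^sub>R (x k - x (k - 1))
          - ((- (t k)\<^sup>2 + t k + (t (k - 1))\<^sup>2) / ((t (k - 1))\<^sup>2 * t k)) *\<^sub>R x k"
    and x: "\<And>k. k \<ge> 2 \<Longrightarrow> x k \<in> D"
    and step: "eventually (\<lambda>k. \<forall>w\<in>D. \<Phi> k (x (Suc k)) + 1 / (2 * s) * (norm (w - x (Suc k)))\<^sup>2
      \<le> \<Phi> k w + 1 / (2 * s) * (norm (w - y k))\<^sup>2) sequentially"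
    and m: "m > 0"
      "eventually (\<lambda>k. m * t k \<le> - (t k)\<^sup>2 + t k + (t (k - 1))\<^sup>2) sequentially"
    and t\<epsilon>: "mono_on {k\<^sub>1..} (\<lambda>k. (t k)\<^sup>2 * \<epsilon> k)"
      "filterlim (\<lambda>k. (t k)\<^sup>2 * \<epsilon> k) at_top sequentially"
    and \<epsilon>_diff: "(\<lambda>k. t k * (\<epsilon> k - \<epsilon> (Suc k)) / \<epsilon> k) \<longlonglongrightarrow> 0"
    and q: "q \<in> D" "\<And>w. w \<in> D \<Longrightarrow> h q \<le> h w"
    and xb: "\<And>k. k \<ge> 1 \<Longrightarrow> xb k \<in> D"
      "\<And>k w. k \<ge> 1 \<Longrightarrow> w \<in> D \<Longrightarrow>
        \<Phi> k (xb k) + \<epsilon> k / 2 * (norm (w - xb k))\<^sup>2 \<le> \<Phi> k w"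
    and xb_lim: "xb \<longlonglongrightarrow> q"
begin

definition \<gamma> :: "nat \<Rightarrow> real" where
  "\<gamma> k = (- (t k)\<^sup>2 + t k + (t (k - 1))\<^sup>2) / (t (k - 1))\<^sup>2"

definition z :: "nat \<Rightarrow> 'a" where
  "z k = x (k - 1) + t (k - 1) *\<^sub>R (x k - x (k - 1))"

definition energy :: "nat \<Rightarrow> real" where
  "energy k = (t (k - 1))\<^sup>2 * (\<Phi> k (x k) - \<Phi> k q) + 1 / (2 * s) * (norm (z k - q))\<^sup>2"

section \<open>Parameters and auxiliary sequence\<close>

lemma t_ge_1: "1 \<le> t k"
proof (induction k)
  case (Suc k)
  then show ?case using t [of "Suc k"] by simp
qed (simp add: t0)

text \<open>Makes \<open>t k\<close> and \<open>t (k - 1)\<close> interchangeable up to a constant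
  in the rates.\<close>

lemma t_le_double: "t k \<le> 2 * t (k - 1)" if "k \<ge> 1"
proof -
  have "1 + 4 * (t (k - 1))\<^sup>2 \<le> (1 + 2 * t (k - 1))\<^sup>2"
    using t_ge_1 [of "k - 1"] by (simp add: power2_eq_square algebra_simps)
  then have "sqrt (1 + 4 * (t (k - 1))\<^sup>2) \<le> 1 + 2 * t (k - 1)"
    using t_ge_1 [of "k - 1"] by (intro real_le_lsqrt) auto
  then show ?thesis using t [OF that] t_ge_1 [of "k - 1"] by argo
qed

lemma \<gamma>_props:
  assumes "k \<ge> 1"
  shows "0 < \<gamma> k" "\<gamma> k \<le> 1" "(1 - \<gamma> k) * (t (k - 1))\<^sup>2 = (t k)\<^sup>2 - t k"
proof -
  have t': "0 < (t (k - 1))\<^sup>2" using t_ge_1 [of "k - 1"] by simp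
  have "2 * t k - 1 < sqrt (1 + 4 * (t (k - 1))\<^sup>2)" using t [OF assms] by argo
  then have "(2 * t k - 1)\<^sup>2 < (sqrt (1 + 4 * (t (k - 1))\<^sup>2))\<^sup>2"
    using t_ge_1 [of k] by (intro power_strict_mono) auto
  then have "(t k)\<^sup>2 - t k < (t (k - 1))\<^sup>2"
    by (simp add: power2_eq_square algebra_simps)
  then show "0 < \<gamma> k" using t' by (simp add: \<gamma>_def)
  have "t k \<le> (t k)\<^sup>2" using t_ge_1 [of k] by (simp add: power2_eq_square)
  then show "\<gamma> k \<le> 1" using t' by (simp add: \<gamma>_def)
  show "(1 - \<gamma> k) * (t (k - 1))\<^sup>2 = (t k)\<^sup>2 - t k"
    using t' by (simp add: \<gamma>_def field_simps)
qed

lemma z_minus_x: "z k - x k = (t (k - 1) - 1) *\<^sub>R (x k - x (k - 1))"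
  by (simp add: z_def algebra_simps)

lemma y_eq:
  assumes "k \<ge> 1"
  shows "t k *\<^sub>R y k = (t k - 1) *\<^sub>R x k + (1 - \<gamma> k) *\<^sub>R z k"
proof -
  have t': "t (k - 1) \<noteq> 0" "t k \<noteq> 0" using t_ge_1 [of "k - 1"] t_ge_1 [of k] by auto
  have c: "t k * ((t k - 1) * (t (k - 1) - 1) / (t (k - 1))\<^sup>2) = (1 - \<gamma> k) * (t (k - 1) - 1)"
      "t k * ((- (t k)\<^sup>2 + t k + (t (k - 1))\<^sup>2) / ((t (k - 1))\<^sup>2 * t k)) = \<gamma> k"
    using t' by (simp_all add: \<gamma>_def field_simps power2_eq_square)
  have "t k *\<^sub>R y k = t k *\<^sub>R x k + (1 - \<gamma> k) *\<^sub>R (z k - x k) - \<gamma> k *\<^sub>R x k"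
    unfolding y [OF assms] z_minus_x scaleR_add_right scaleR_diff_right [of "t k" "_ + _"]
      scaleR_scaleR c ..
  then show ?thesis by (simp add: algebra_simps)
qed

lemma eventually_ge_1: "eventually (\<lambda>k. 1 \<le> k) sequentially"
  by (rule eventually_ge_at_top)

lemma energy_Suc_le:
  "eventually (\<lambda>k. energy (Suc k) \<le> (1 - \<gamma> k) * energy k
    + \<gamma> k / (2 * s) * (norm q)\<^sup>2 + (t k)\<^sup>2 * (\<epsilon> k - \<epsilon> (Suc k)) / 2 * (norm q)\<^sup>2) sequentially"
  using step eventually_ge_at_top [of 2]
proof eventually_elim
  case (elim k)
  then have k: "1 \<le> k" by simp
  have "\<epsilon> (Suc k) \<le> \<epsilon> k" using \<epsilon>(2) k by (auto simp: monotone_on_def)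
  then show ?case
    unfolding energy_def z_def [of "Suc k"] diff_Suc_1 \<Phi>_def
    using \<epsilon>(1) [OF k] \<gamma>_props [OF k] elim x [of k] unfolding \<Phi>_def
    by (intro energy_step [OF h s _ _ t_ge_1 _ _ _ _ q(1) y_eq [OF k]]) auto
qed

text \<open>The damped recursion applies with \<open>S k = (t k)\<^sup>2 * \<epsilon> k\<close>;
  each of the two error terms takes half of \<open>\<eta>\<close>. The first is negligible because
  \<open>S\<close> diverges, the second because of \<open>\<epsilon>_diff\<close>.\<close>

lemma energy_small:
  assumes \<eta>: "\<eta> > 0"
  shows "eventually (\<lambda>k. energy k \<le> \<eta> * ((t k)\<^sup>2 * \<epsilon> k)) sequentially"
proof (rule damped_recursion_bound [OF t\<epsilon> _ _ \<eta>])
  show "eventually (\<lambda>k. 0 \<le> \<gamma> k \<and> \<gamma> k \<le> 1) sequentially"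
    using eventually_ge_1
  proof eventually_elim
    case (elim k)
    then show ?case using \<gamma>_props [OF elim] by simp
  qed
  fix \<eta> :: real assume \<eta>: "\<eta> > 0"
  have "eventually (\<lambda>k. (norm q)\<^sup>2 / (\<eta> * s) \<le> (t k)\<^sup>2 * \<epsilon> k) sequentially"
    using t\<epsilon>(2) by (auto simp: filterlim_at_top)
  moreover have "(\<lambda>k. t k * (\<epsilon> k - \<epsilon> (Suc k)) / \<epsilon> k * (norm q)\<^sup>2) \<longlonglongrightarrow> 0 * (norm q)\<^sup>2"
    by (intro tendsto_intros \<epsilon>_diff)
  then have "eventually (\<lambda>k. t k * (\<epsilon> k - \<epsilon> (Suc k)) / \<epsilon> k * (norm q)\<^sup>2 < m * \<eta>) sequentially"
    by (rule order_tendstoD) (use m \<eta> in simp)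
  ultimately show "eventually (\<lambda>k. energy (Suc k) \<le> (1 - \<gamma> k) * energy k
      + \<gamma> k * (\<eta> * ((t k)\<^sup>2 * \<epsilon> k))) sequentially"
    using energy_Suc_le m(2) eventually_ge_1
  proof eventually_elim
    case (elim k)
    note \<gamma>k = \<gamma>_props [OF elim(5)] and \<epsilon>k = \<epsilon>(1) [OF elim(5)]
    have t': "t (k - 1) \<le> t k" "1 \<le> t (k - 1)" "1 \<le> t k"
      using t [OF elim(5)] t_ge_1 by auto
    have "(norm q)\<^sup>2 / (2 * s) \<le> \<eta> / 2 * ((t k)\<^sup>2 * \<epsilon> k)"
    proof -
      have "(norm q)\<^sup>2 \<le> (t k)\<^sup>2 * \<epsilon> k * (\<eta> * s)"
        using elim(1) \<eta> s by (simp only: pos_divide_le_eq mult_pos_pos)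
      then show ?thesis using s by (simp add: pos_divide_le_eq mult_ac)
    qed
    then have "\<gamma> k * ((norm q)\<^sup>2 / (2 * s)) \<le> \<gamma> k * (\<eta> / 2 * ((t k)\<^sup>2 * \<epsilon> k))"
      using \<gamma>k(1) by (intro mult_left_mono) auto
    then have 1: "\<gamma> k / (2 * s) * (norm q)\<^sup>2 \<le> \<gamma> k * (\<eta> / 2 * ((t k)\<^sup>2 * \<epsilon> k))" by simp
    have 2: "(t k)\<^sup>2 * (\<epsilon> k - \<epsilon> (Suc k)) / 2 * (norm q)\<^sup>2 \<le> \<gamma> k * (\<eta> / 2 * ((t k)\<^sup>2 * \<epsilon> k))"
    proof -
      \<comment> \<open>The damping is at least \<open>m / t k\<close>, which is what lets it
        dominate the drift of \<open>\<epsilon>\<close>.\<close>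
      have "m * t k / (t k)\<^sup>2 \<le> m * t k / (t (k - 1))\<^sup>2"
        using t' m(1) by (intro divide_left_mono power_mono) auto
      also have "\<dots> \<le> \<gamma> k"
        unfolding \<gamma>_def using elim(4) by (intro divide_right_mono) auto
      finally have "m / t k \<le> \<gamma> k"
        using t' by (simp add: power2_eq_square)
      then have "m \<le> \<gamma> k * t k"
        using t' by (simp add: pos_divide_le_eq)
      then have "m * \<eta> \<le> (\<gamma> k * t k) * \<eta>" using \<eta> by (intro mult_right_mono) auto
      with elim(2) have "t k * (\<epsilon> k - \<epsilon> (Suc k)) / \<epsilon> k * (norm q)\<^sup>2 \<le> \<gamma> k * t k * \<eta>"
        by linarith
      then have "t k * (\<epsilon> k - \<epsilon> (Suc k)) * (norm q)\<^sup>2 \<le> \<gamma> k * t k * \<eta> * \<epsilon> k"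
        using \<epsilon>k by (simp add: pos_divide_le_eq)
      then have "t k / 2 * (t k * (\<epsilon> k - \<epsilon> (Suc k)) * (norm q)\<^sup>2)
          \<le> t k / 2 * (\<gamma> k * t k * \<eta> * \<epsilon> k)"
        using t' by (intro mult_left_mono) auto
      then show ?thesis by (simp add: power2_eq_square mult_ac)
    qed
    note elim(3)
    also note add_mono [OF add_mono [OF order.refl 1] 2]
    finally show ?case by (simp add: mult_ac add_ac)
  qed
qed

section \<open>Regularized gap and strong convergence\<close>

text \<open>Since \<open>q\<close> minimizes \<open>h\<close>, only the penalties remain; their
  difference is o(\<open>\<epsilon>\<close>) because the path converges strongly to
  \<open>q\<close>.\<close>

lemma gap_xb:
  assumes "k \<ge> 1"
  shows "\<Phi> k q - \<Phi> k (xb k) \<le> \<epsilon> k / 2 * ((norm q)\<^sup>2 - (norm (xb k))\<^sup>2)"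
  using q(2) [OF xb(1) [OF assms]] unfolding \<Phi>_def by (simp add: algebra_simps)

lemma \<Phi>_xb_le: "k \<ge> 1 \<Longrightarrow> w \<in> D \<Longrightarrow> \<Phi> k (xb k) \<le> \<Phi> k w"
  using \<epsilon>(1) [of k] by (intro order.trans [OF _ xb(2)]) auto

lemma gap_xb_small:
  assumes \<eta>: "\<eta> > 0"
  shows "eventually (\<lambda>k. \<Phi> k q - \<Phi> k (xb k) \<le> \<eta> * \<epsilon> k) sequentially"
proof -
  have "(\<lambda>k. (norm q)\<^sup>2 - (norm (xb k))\<^sup>2) \<longlonglongrightarrow> (norm q)\<^sup>2 - (norm q)\<^sup>2"
    by (intro tendsto_intros xb_lim)
  then have "eventually (\<lambda>k. (norm q)\<^sup>2 - (norm (xb k))\<^sup>2 < 2 * \<eta>) sequentially"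
    by (rule order_tendstoD) (use \<eta> in simp)
  then show ?thesis using eventually_ge_1
  proof eventually_elim
    case (elim k)
    have "\<epsilon> k / 2 * ((norm q)\<^sup>2 - (norm (xb k))\<^sup>2) \<le> \<epsilon> k / 2 * (2 * \<eta>)"
      using elim \<epsilon>(1) [of k] by (intro mult_left_mono) auto
    with gap_xb [of k] elim show ?case by (simp add: mult.commute)
  qed
qed

lemma gap_small: "(\<lambda>k. \<Phi> k (x k) - \<Phi> k (xb k)) \<in> o(\<epsilon>)"
proof (rule landau_o.smallI)
  fix c :: real assume c: "c > 0"
  \<comment> \<open>The bound \<open>t k \<le> 2 * t (k - 1)\<close> costs a factor 4, so
    \<open>c / 8\<close> becomes \<open>c / 2\<close>; the path gap takes the other half.\<close>
  have "c / 8 > 0" "c / 2 > 0" using c by auto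
  from energy_small [OF this(1)] gap_xb_small [OF this(2)] eventually_ge_at_top [of 2]
  show "eventually (\<lambda>k. norm (\<Phi> k (x k) - \<Phi> k (xb k)) \<le> c * norm (\<epsilon> k)) sequentially"
  proof eventually_elim
    case (elim k)
    then have k: "1 \<le> k" by simp
    have t': "0 < (t (k - 1))\<^sup>2" using t_ge_1 [of "k - 1"] by simp
    have "(t k)\<^sup>2 \<le> (2 * t (k - 1))\<^sup>2"
      using t_le_double [OF k] t_ge_1 [of k] by (intro power_mono) auto
    then have "c / 8 * ((t k)\<^sup>2 * \<epsilon> k) \<le> c / 8 * ((2 * t (k - 1))\<^sup>2 * \<epsilon> k)"
      using c \<epsilon>(1) [OF k] by (intro mult_left_mono mult_right_mono) auto
    moreover have "0 \<le> 1 / (2 * s) * (norm (z k - q))\<^sup>2" using s by simp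
    moreover have "c / 8 * ((2 * t (k - 1))\<^sup>2 * \<epsilon> k) = (t (k - 1))\<^sup>2 * (c / 2 * \<epsilon> k)"
      by (simp add: power_mult_distrib)
    ultimately have "(t (k - 1))\<^sup>2 * (\<Phi> k (x k) - \<Phi> k q) \<le> (t (k - 1))\<^sup>2 * (c / 2 * \<epsilon> k)"
      using elim(1) unfolding energy_def by argo
    then have "\<Phi> k (x k) - \<Phi> k q \<le> c / 2 * \<epsilon> k" using t' by simp
    with elim(2) have "\<Phi> k (x k) - \<Phi> k (xb k) \<le> c * \<epsilon> k" by simp
    moreover have "\<Phi> k (xb k) \<le> \<Phi> k (x k)" by (rule \<Phi>_xb_le [OF k x]) (use elim in simp)
    ultimately show ?case using \<epsilon>(1) [OF k] by simp
  qed
qed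

text \<open>The function part of \<open>energy\<close> may be negative, but by minimality of
  \<open>xb k\<close> no more so than the path gap at \<open>q\<close> allows. Adding that gap
  isolates the squared distance.\<close>

lemma z_small: "(\<lambda>k. norm (z k - q)) \<in> o(\<lambda>k. t k * sqrt (\<epsilon> k))"
proof (rule landau_o.smallI)
  fix c :: real assume c: "c > 0"
  define \<eta> where "\<eta> = c\<^sup>2 / (4 * s)"
  have "\<eta> > 0" using c s by (simp add: \<eta>_def)
  from energy_small [OF this] gap_xb_small [OF this] eventually_ge_at_top [of 2]
  show "eventually (\<lambda>k. norm (norm (z k - q)) \<le> c * norm (t k * sqrt (\<epsilon> k))) sequentially"
  proof eventually_elim
    case (elim k)
    then have k: "1 \<le> k" by simp
    have tk: "1 \<le> t (k - 1)" "t (k - 1) \<le> t k" using t_ge_1 t [OF k] by auto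
    have "\<Phi> k q - \<Phi> k (x k) \<le> \<eta> * \<epsilon> k"
      using elim(2) \<Phi>_xb_le [OF k x [OF elim(3)]] by linarith
    then have "(t (k - 1))\<^sup>2 * (\<Phi> k q - \<Phi> k (x k)) \<le> (t (k - 1))\<^sup>2 * (\<eta> * \<epsilon> k)"
      by (intro mult_left_mono) auto
    also have "\<dots> \<le> (t k)\<^sup>2 * (\<eta> * \<epsilon> k)"
      using tk \<open>\<eta> > 0\<close> \<epsilon>(1) [OF k] by (intro mult_right_mono power_mono) auto
    finally have *: "(t (k - 1))\<^sup>2 * (\<Phi> k q - \<Phi> k (x k)) \<le> (t k)\<^sup>2 * (\<eta> * \<epsilon> k)" .
    have "1 / (2 * s) * (norm (z k - q))\<^sup>2 = energy k + (t (k - 1))\<^sup>2 * (\<Phi> k q - \<Phi> k (x k))"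
      unfolding energy_def by (simp add: algebra_simps)
    also note add_mono [OF elim(1) *]
    also have "\<eta> * ((t k)\<^sup>2 * \<epsilon> k) + (t k)\<^sup>2 * (\<eta> * \<epsilon> k) = 1 / (2 * s) * (c\<^sup>2 * ((t k)\<^sup>2 * \<epsilon> k))"
      by (simp add: \<eta>_def)
    finally have "(norm (z k - q))\<^sup>2 \<le> c\<^sup>2 * ((t k)\<^sup>2 * \<epsilon> k)"
      by (rule mult_left_le_imp_le) (simp add: s)
    also have "\<dots> = (c * (t k * sqrt (\<epsilon> k)))\<^sup>2"
      using \<epsilon>(1) [OF k] by (simp add: power_mult_distrib)
    finally have "norm (z k - q) \<le> c * (t k * sqrt (\<epsilon> k))"
      by (rule power2_le_imp_le) (use c tk \<epsilon>(1) [OF k] in simp)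
    then show ?case using tk \<epsilon>(1) [OF k] by (simp add: abs_mult)
  qed
qed

text \<open>Strong convexity of \<open>\<Phi> k\<close> bounds the squared distance from
  \<open>x k\<close> to \<open>xb k\<close> by twice the gap divided by \<open>\<epsilon> k\<close>,
  which vanishes.\<close>

lemma x_lim: "x \<longlonglongrightarrow> q"
proof -
  have "(\<lambda>k. (\<Phi> k (x k) - \<Phi> k (xb k)) / \<epsilon> k) \<longlonglongrightarrow> 0"
    by (rule smalloD_tendsto [OF gap_small])
  then have "(\<lambda>k. 2 * ((\<Phi> k (x k) - \<Phi> k (xb k)) / \<epsilon> k)) \<longlonglongrightarrow> 2 * 0"
    by (intro tendsto_intros)
  then have "(\<lambda>k. 2 * ((\<Phi> k (x k) - \<Phi> k (xb k)) / \<epsilon> k)) \<longlonglongrightarrow> 0" by simp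
  moreover have "eventually (\<lambda>k. norm ((norm (x k - xb k))\<^sup>2) \<le> 2 * ((\<Phi> k (x k) - \<Phi> k (xb k)) / \<epsilon> k))
      sequentially"
    using eventually_ge_at_top [of 2]
  proof eventually_elim
    case (elim k)
    then show ?case using xb(2) [of k "x k"] x [of k] \<epsilon>(1) [of k] by (simp add: field_simps)
  qed
  ultimately have "(\<lambda>k. (norm (x k - xb k))\<^sup>2) \<longlonglongrightarrow> 0"
    by (rule Lim_null_comparison [rotated])
  then have "(\<lambda>k. sqrt ((norm (x k - xb k))\<^sup>2)) \<longlonglongrightarrow> sqrt 0"
    by (rule tendsto_real_sqrt)
  then have "(\<lambda>k. x k - xb k) \<longlonglongrightarrow> 0"
    by (simp add: tendsto_norm_zero_iff)
  from tendsto_add [OF this xb_lim] show ?thesis by simp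
qed

section \<open>Rates for increments, extrapolation and values\<close>

lemma t_sqrt_\<epsilon>_lim: "filterlim (\<lambda>k. t k * sqrt (\<epsilon> k)) at_top sequentially"
proof -
  have "filterlim (\<lambda>k. sqrt ((t k)\<^sup>2 * \<epsilon> k)) at_top sequentially"
    by (rule filterlim_compose [OF sqrt_at_top t\<epsilon>(2)])
  moreover have "sqrt ((t k)\<^sup>2 * \<epsilon> k) = t k * sqrt (\<epsilon> k)" for k
    using t_ge_1 [of k] by (simp add: real_sqrt_mult)
  ultimately show ?thesis by simp
qed

lemma bounded_small:
  assumes "w \<longlonglongrightarrow> (p :: 'a)"
  shows "(\<lambda>k. norm (w k)) \<in> o(\<lambda>k. t k * sqrt (\<epsilon> k))"
proof (rule smalloI_tendsto)
  show "(\<lambda>k. norm (w k) / (t k * sqrt (\<epsilon> k))) \<longlonglongrightarrow> 0"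
    by (rule real_tendsto_divide_at_top [OF tendsto_norm [OF assms] t_sqrt_\<epsilon>_lim])
  show "eventually (\<lambda>k. t k * sqrt (\<epsilon> k) \<noteq> 0) sequentially"
    using eventually_ge_1
  proof eventually_elim
    case (elim k)
    show ?case using t_ge_1 [of k] \<epsilon>(1) [OF elim] by simp
  qed
qed

lemma small_of_weighted:
  assumes b: "b \<in> o(\<lambda>k. t k * sqrt (\<epsilon> k))" and C: "C > 0"
    and le: "eventually (\<lambda>k. t k * norm (w k :: 'a) \<le> C * b k) sequentially"
  shows "(\<lambda>k. norm (w k)) \<in> o(\<lambda>k. sqrt (\<epsilon> k))"
proof (rule landau_o.smallI)
  fix c :: real assume c: "c > 0"
  have "c / C > 0" using c C by simp
  from landau_o.smallD [OF b this] le eventually_ge_1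
  show "eventually (\<lambda>k. norm (norm (w k)) \<le> c * norm (sqrt (\<epsilon> k))) sequentially"
  proof eventually_elim
    case (elim k)
    have tk: "0 < t k" using t_ge_1 [of k] by simp
    have "C * b k \<le> C * (c / C * (t k * sqrt (\<epsilon> k)))"
      using elim C tk \<epsilon>(1) [OF elim(3)] by (intro mult_left_mono) (auto simp: abs_mult)
    with elim(2) have "t k * norm (w k) \<le> t k * (c * sqrt (\<epsilon> k))"
      using C by (simp add: mult_ac)
    then show ?case using tk \<epsilon>(1) [OF elim(3)] by simp
  qed
qed

lemma z_minus_x_small: "(\<lambda>k. norm (z k - x k)) \<in> o(\<lambda>k. t k * sqrt (\<epsilon> k))"
proof -
  have "(\<lambda>k. x k - q) \<longlonglongrightarrow> q - q" by (intro tendsto_intros x_lim)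
  then have "(\<lambda>k. norm (z k - q) + norm (x k - q)) \<in> o(\<lambda>k. t k * sqrt (\<epsilon> k))"
    by (intro sum_in_smallo z_small bounded_small)
  then show ?thesis
  proof (rule landau_o.big_small_trans [rotated])
    have "norm (z k - x k) \<le> norm (z k - q) + norm (x k - q)" for k
      using norm_triangle_ineq4 [of "z k - q" "x k - q"] by simp
    then show "(\<lambda>k. norm (z k - x k)) \<in> O(\<lambda>k. norm (z k - q) + norm (x k - q))"
      by (intro landau_o.big_mono) auto
  qed
qed

lemma t_at_top: "filterlim t at_top sequentially"
proof (rule filterlim_at_top_mono [OF t_sqrt_\<epsilon>_lim])
  have "eventually (\<lambda>k. \<epsilon> k < 1) sequentially" using \<epsilon>(3) by (rule order_tendstoD) simp
  then show "eventually (\<lambda>k. t k * sqrt (\<epsilon> k) \<le> t k) sequentially"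
  proof eventually_elim
    case (elim k)
    then show ?case using t_ge_1 [of k] by (intro mult_left_le) auto
  qed
qed

lemma step_small: "(\<lambda>k. norm (x k - x (k - 1))) \<in> o(\<lambda>k. sqrt (\<epsilon> k))"
proof (rule small_of_weighted [OF z_minus_x_small])
  \<comment> \<open>From \<open>4 \<le> t k\<close> and \<open>t k \<le> 2 * t (k - 1)\<close>
    follows \<open>t k \<le> 4 * (t (k - 1) - 1)\<close>, which bounds the increment by
    \<open>z k - x k\<close>.\<close>
  have "eventually (\<lambda>k. 4 \<le> t k) sequentially"
    using t_at_top by (auto simp: filterlim_at_top)
  then show "eventually (\<lambda>k. t k * norm (x k - x (k - 1)) \<le> 4 * norm (z k - x k)) sequentially"
    using eventually_ge_1
  proof eventually_elim
    case (elim k)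
    have "t k \<le> 4 * (t (k - 1) - 1)" using t_le_double [OF elim(2)] elim(1) by argo
    then have "t k * norm (x k - x (k - 1)) \<le> 4 * (t (k - 1) - 1) * norm (x k - x (k - 1))"
      by (intro mult_right_mono) auto
    moreover have "norm (z k - x k) = (t (k - 1) - 1) * norm (x k - x (k - 1))"
      unfolding z_minus_x using t_ge_1 [of "k - 1"] by simp
    ultimately show ?case by (simp only: mult.assoc)
  qed
qed simp

text \<open>After scaling by \<open>t k\<close>, the difference is \<open>\<gamma> k *\<^sub>R x k -
  (1 - \<gamma> k) *\<^sub>R (z k - x k)\<close>. The first part is bounded and
  \<open>t k * sqrt (\<epsilon> k)\<close> diverges.\<close>

lemma x_minus_y_small: "(\<lambda>k. norm (x k - y k)) \<in> o(\<lambda>k. sqrt (\<epsilon> k))"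
proof (rule small_of_weighted [of _ 1])
  show "(\<lambda>k. norm (z k - x k) + norm (x k)) \<in> o(\<lambda>k. t k * sqrt (\<epsilon> k))"
    by (intro sum_in_smallo z_minus_x_small bounded_small [OF x_lim])
  show "eventually (\<lambda>k. t k * norm (x k - y k) \<le> 1 * (norm (z k - x k) + norm (x k))) sequentially"
    using eventually_ge_1
  proof eventually_elim
    case (elim k)
    have "t k *\<^sub>R (x k - y k) = \<gamma> k *\<^sub>R x k - (1 - \<gamma> k) *\<^sub>R (z k - x k)"
      using y_eq [OF elim] by (simp add: algebra_simps)
    then have "norm (t k *\<^sub>R (x k - y k)) \<le> norm (\<gamma> k *\<^sub>R x k) + norm ((1 - \<gamma> k) *\<^sub>R (z k - x k))"
      by (simp only: norm_triangle_ineq4)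
    also have "\<dots> \<le> 1 * norm (x k) + 1 * norm (z k - x k)"
      unfolding norm_scaleR using \<gamma>_props [OF elim] by (intro add_mono mult_right_mono) auto
    finally show ?case using t_ge_1 [of k] by simp
  qed
qed simp

lemma sqrt_\<epsilon>_lim: "(\<lambda>k. sqrt (\<epsilon> k)) \<longlonglongrightarrow> 0"
  using tendsto_real_sqrt [OF \<epsilon>(3)] by simp

lemma y_lim: "y \<longlonglongrightarrow> q"
proof -
  have "eventually (\<lambda>k. norm (x k - y k) \<le> 1 * norm (sqrt (\<epsilon> k))) sequentially"
    using landau_o.smallD [OF x_minus_y_small, of 1] by simp
  moreover have "(\<lambda>k. 1 * norm (sqrt (\<epsilon> k))) \<longlonglongrightarrow> 0"
    using tendsto_norm_zero [OF sqrt_\<epsilon>_lim] by simp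
  ultimately have "(\<lambda>k. x k - y k) \<longlonglongrightarrow> 0"
    by (rule Lim_null_comparison)
  from tendsto_diff [OF x_lim this] show ?thesis by simp
qed

text \<open>Comparison with \<open>q\<close> leaves its penalty, a fixed multiple of
  \<open>\<epsilon> k\<close>, so this argument gives the order \<open>\<epsilon>\<close>
  only.\<close>

lemma value_big: "(\<lambda>k. h (x k) - h q) \<in> O(\<epsilon>)"
proof (rule bigoI)
  have "eventually (\<lambda>k. norm (\<Phi> k (x k) - \<Phi> k (xb k)) \<le> 1 * norm (\<epsilon> k)) sequentially"
    using landau_o.smallD [OF gap_small, of 1] by simp
  then show "eventually (\<lambda>k. norm (h (x k) - h q) \<le> (1 + (norm q)\<^sup>2 / 2) * norm (\<epsilon> k)) sequentially"
    using eventually_ge_at_top [of 2]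
  proof eventually_elim
    case (elim k)
    then have k: "1 \<le> k" by simp
    have "\<Phi> k (x k) \<le> \<Phi> k q + \<epsilon> k"
      using elim(1) \<Phi>_xb_le [OF k q(1)] \<epsilon>(1) [OF k] by simp
    moreover have "0 \<le> \<epsilon> k * (norm (x k))\<^sup>2" using \<epsilon>(1) [OF k] by simp
    ultimately have "h (x k) \<le> h q + (1 + (norm q)\<^sup>2 / 2) * \<epsilon> k"
      unfolding \<Phi>_def by (simp add: algebra_simps)
    then show ?case using q(2) [OF x [OF elim(2)]] \<epsilon>(1) [OF k] by simp
  qed
qed

text \<open>The residual at \<open>x k\<close> involves the data of index \<open>k - 1\<close>, so
  the rate must be moved one index forward. This needs bounded ratios of successive
  \<open>\<epsilon>\<close>.\<close>

lemma residual_small: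
  assumes "C \<ge> 0" and le: "\<And>k. k \<ge> 2 \<Longrightarrow>
    norm (u k :: 'a) \<le> C * norm (y (k - 1) - x k) + \<epsilon> (k - 1) * norm (y (k - 1))"
  shows "(\<lambda>k. norm (u k)) \<in> o(\<lambda>k. sqrt (\<epsilon> k))"
proof -
  have shift: "filterlim (\<lambda>k. k - 1) sequentially sequentially"
    by (rule filterlim_minus_const_nat_at_top)
  have y: "(\<lambda>k. \<epsilon> k * norm (y k)) \<in> o(\<lambda>k. sqrt (\<epsilon> k))"
  proof (rule smalloI_tendsto)
    have "(\<lambda>k. sqrt (\<epsilon> k) * norm (y k)) \<longlonglongrightarrow> 0 * norm q"
      by (intro tendsto_intros sqrt_\<epsilon>_lim y_lim)
    moreover have "eventually (\<lambda>k. sqrt (\<epsilon> k) * norm (y k) = \<epsilon> k * norm (y k) / sqrt (\<epsilon> k))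
        sequentially"
      using eventually_ge_1
    proof eventually_elim
      case (elim k)
      show ?case using \<epsilon>(1) [OF elim] by (simp add: field_simps)
    qed
    ultimately show "(\<lambda>k. \<epsilon> k * norm (y k) / sqrt (\<epsilon> k)) \<longlonglongrightarrow> 0"
      by (simp add: tendsto_cong)
    show "eventually (\<lambda>k. sqrt (\<epsilon> k) \<noteq> 0) sequentially"
      using eventually_ge_1
    proof eventually_elim
      case (elim k)
      show ?case using \<epsilon>(1) [OF elim] by simp
    qed
  qed
  \<comment> \<open>Since \<open>t k \<ge> 1\<close>, the relative decrease of
    \<open>\<epsilon>\<close> in one step is eventually below one half.\<close>
  have half: "eventually (\<lambda>k. \<epsilon> k \<le> 2 * \<epsilon> (Suc k)) sequentially"
  proof -
    have "eventually (\<lambda>k. t k * (\<epsilon> k - \<epsilon> (Suc k)) / \<epsilon> k < 1 / 2) sequentially"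
      using \<epsilon>_diff by (rule order_tendstoD) simp
    then show ?thesis using eventually_ge_1
    proof eventually_elim
      case (elim k)
      have "0 \<le> \<epsilon> k - \<epsilon> (Suc k)" using \<epsilon>(2) elim by (auto simp: monotone_on_def)
      then have "1 * (\<epsilon> k - \<epsilon> (Suc k)) \<le> t k * (\<epsilon> k - \<epsilon> (Suc k))"
        using t_ge_1 by (intro mult_right_mono)
      moreover have "t k * (\<epsilon> k - \<epsilon> (Suc k)) < \<epsilon> k / 2"
        using elim \<epsilon>(1) [of k] by (simp add: field_simps)
      ultimately show ?case by simp
    qed
  qed
  have ratio: "(\<lambda>k. sqrt (\<epsilon> (k - 1))) \<in> O(\<lambda>k. sqrt (\<epsilon> k))"
  proof (rule bigoI)
    have "eventually (\<lambda>k. \<epsilon> (k - 1) \<le> 2 * \<epsilon> (Suc (k - 1))) sequentially"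
      using eventually_compose_filterlim [OF half shift] .
    then show "eventually (\<lambda>k. norm (sqrt (\<epsilon> (k - 1))) \<le> sqrt 2 * norm (sqrt (\<epsilon> k))) sequentially"
      using eventually_ge_at_top [of 2]
    proof eventually_elim
      case (elim k)
      then have "0 < \<epsilon> (k - 1)" by (intro \<epsilon>(1)) simp
      then show ?case using elim \<epsilon>(1) [of k] by (simp flip: real_sqrt_mult)
    qed
  qed
  let ?b = "\<lambda>k. C * (norm (x (k - 1) - y (k - 1)) + norm (x k - x (k - 1)))
      + \<epsilon> (k - 1) * norm (y (k - 1))"
  have "(\<lambda>k. norm (x (k - 1) - y (k - 1))) \<in> o(\<lambda>k. sqrt (\<epsilon> k))"
    by (rule landau_o.small_big_trans [OF landau_o.small.compose [OF x_minus_y_small shift] ratio])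
  moreover have "(\<lambda>k. \<epsilon> (k - 1) * norm (y (k - 1))) \<in> o(\<lambda>k. sqrt (\<epsilon> k))"
    by (rule landau_o.small_big_trans [OF landau_o.small.compose [OF y shift] ratio])
  ultimately have "?b \<in> o(\<lambda>k. sqrt (\<epsilon> k))"
    using step_small by (intro sum_in_smallo cmult_smallo)
  then show ?thesis
  proof (rule landau_o.big_small_trans [rotated], intro bigoI [of _ 1])
    show "eventually (\<lambda>k. norm (norm (u k)) \<le> 1 * norm (?b k)) sequentially"
      using eventually_ge_at_top [of 2]
    proof eventually_elim
      case (elim k)
      have "norm (y (k - 1) - x k) \<le> norm (x (k - 1) - y (k - 1)) + norm (x k - x (k - 1))"
        using norm_triangle_ineq [of "y (k - 1) - x (k - 1)" "x (k - 1) - x k"]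
        by (simp add: norm_minus_commute)
      then have "C * norm (y (k - 1) - x k)
          \<le> C * (norm (x (k - 1) - y (k - 1)) + norm (x k - x (k - 1)))"
        using assms(1) by (intro mult_left_mono)
      from order.trans [OF order.trans [OF le [OF elim] add_right_mono [OF this]] abs_ge_self]
      show ?case by (simp only: real_norm_def abs_norm_cancel mult_1_left)
    qed
  qed
qed

end

section \<open>Transfer to the extended-valued problem\<close>

theorem theorem4:
  fixes f :: "'a::{real_inner,complete_space} \<Rightarrow> ereal"
    and g :: "'a \<Rightarrow> real"
    and grad_g :: "'a \<Rightarrow> 'a"
    and L s :: real
    and t \<epsilon> :: "nat \<Rightarrow> real"
    and x y :: "nat \<Rightarrow> 'a"
    and F :: "nat \<Rightarrow> 'a \<Rightarrow> ereal"
    and k0 :: nat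
  assumes f: "proper_fun f" "convex_fun f" "lsc_fun f"
    and g: "convex_on UNIV g" "\<And>z. GDERIV g z :> grad_g z" "continuous_on UNIV grad_g"
    and L: "L > 0" "L-lipschitz_on UNIV grad_g"
    and min_ex: "argmin_set (\<lambda>z. f z + ereal (g z)) \<noteq> {}"
    and t0: "t 0 = 1"
    and t: "\<And>k. k \<ge> 1 \<Longrightarrow>
      t (k - 1) < t k \<and> t k < (1 + sqrt (1 + 4 * (t (k - 1))\<^sup>2)) / 2"
    and eps: "\<And>k. k \<ge> 1 \<Longrightarrow> \<epsilon> k > 0" "antimono_on {1..} \<epsilon>" "\<epsilon> \<longlonglongrightarrow> 0"
    and s: "0 < s" "s < 1 / L"
    and y: "\<And>k. k \<ge> 1 \<Longrightarrow> y k =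
      x k + ((t k - 1) * (t (k - 1) - 1) / (t (k - 1))\<^sup>2) *\<^sub>R (x k - x (k - 1))
          - ((- (t k)\<^sup>2 + t k + (t (k - 1))\<^sup>2) / ((t (k - 1))\<^sup>2 * t k)) *\<^sub>R x k"
    and x: "\<And>k. k \<ge> 1 \<Longrightarrow>
      x (k + 1) = prox s f (y k - s *\<^sub>R grad_g (y k) - (s * \<epsilon> k) *\<^sub>R y k)"
    and F: "\<And>k z. F k z = f z + ereal (g z) + ereal (\<epsilon> k / 2 * (norm z)\<^sup>2)"
    and k0: "k0 \<ge> 2" "s \<in> {0<..1 / (L + \<epsilon> k0)}"
    and liminf_t: "liminf (\<lambda>k. ereal ((- (t k)\<^sup>2 + t k + (t (k - 1))\<^sup>2) / t k)) > 0"
    and t_eps_mono: "mono_on {k0 - 1..} (\<lambda>k. (t k)\<^sup>2 * \<epsilon> k)"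
    and t_eps_lim: "filterlim (\<lambda>k. (t k)\<^sup>2 * \<epsilon> k) at_top sequentially"
    and eps_diff: "(\<lambda>k. t k * (\<epsilon> k - \<epsilon> (k + 1)) / \<epsilon> k) \<longlonglongrightarrow> 0"
  shows "(\<exists>xs. {xs} = metric_proj (argmin_set (\<lambda>z. f z + ereal (g z))) 0
              \<and> x \<longlonglongrightarrow> xs \<and> y \<longlonglongrightarrow> xs)
    \<and> (\<lambda>k. norm (x k - y k)) \<in> o(\<lambda>k. sqrt (\<epsilon> k))
    \<and> (\<forall>k\<ge>2. f (x k) \<noteq> \<infinity>)
    \<and> (\<exists>xbar. (\<forall>k\<ge>1. argmin_set (F k) = {xbar k})
              \<and> (\<lambda>k. real_of_ereal (F k (x k) - F k (xbar k))) \<in> o(\<epsilon>))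
    \<and> (\<lambda>k. real_of_ereal (f (x k) + ereal (g (x k)) - (INF z. f z + ereal (g z)))) \<in> O(\<epsilon>)
    \<and> (\<lambda>k. norm (x k - x (k - 1))) \<in> o(\<lambda>k. sqrt (\<epsilon> k))
    \<and> (\<exists>u. (\<forall>k\<ge>2. u k \<in> (\<lambda>v. v + grad_g (x k)) ` subdifferential f (x k))
           \<and> (\<lambda>k. norm (u k)) \<in> o(\<lambda>k. sqrt (\<epsilon> k)))"
proof -
  define D where "D = edom f"
  define h where "h z = rval f z + g z" for z
  define c where "c k = - (t k)\<^sup>2 + t k + (t (k - 1))\<^sup>2" for k
  have argmin: "argmin_set (\<lambda>z. f z + ereal (g z)) = {p \<in> D. \<forall>z\<in>D. h p \<le> h z}"
    unfolding argmin_set_ereal_add [OF f(1)] D_def h_def ..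
  obtain q0 where q0: "q0 \<in> D" "\<And>z. z \<in> D \<Longrightarrow> h q0 \<le> h z"
    using min_ex unfolding argmin by auto
  have conv_f: "convex_on D (rval f)" unfolding D_def by (rule convex_on_rval [OF f(1,2)])
  have conv: "convex_on D h"
    unfolding h_def
    by (intro convex_on_add conv_f convex_on_subset [OF g(1)] convex_on_imp_convex [OF conv_f]) simp
  have "continuous_on UNIV g"
    using g(2) has_derivative_continuous unfolding gderiv_def continuous_on_eq_continuous_at [OF open_UNIV]
    by blast
  then have epi: "closed (epigraph D h)"
    unfolding h_def D_def by (intro closed_epigraph_add closed_epigraph_lsc_fun f)
  have "\<exists>p\<in>D. \<forall>w\<in>D. h p + \<epsilon> k / 2 * (norm p)\<^sup>2 + \<epsilon> k / 2 * (norm (w - p))\<^sup>2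
      \<le> h w + \<epsilon> k / 2 * (norm w)\<^sup>2" if k: "k \<ge> 1" for k
  proof -
    have ek: "0 < \<epsilon> k / 2" using eps(1) [OF k] by simp
    have "h q0 \<le> h w + \<epsilon> k / 2 * (norm (w - 0))\<^sup>2" if "w \<in> D" for w
      using q0(2) [OF that] ek by (intro add_increasing2) auto
    from strong_minimizer_exists [OF conv epi _ ek this] q0(1) show ?thesis
      by (metis diff_zero empty_iff)
  qed
  then obtain xb where xb: "\<And>k. k \<ge> 1 \<Longrightarrow> xb k \<in> D"
    "\<And>k w. k \<ge> 1 \<Longrightarrow> w \<in> D \<Longrightarrow> h (xb k) + \<epsilon> k / 2 * (norm (xb k))\<^sup>2
      + \<epsilon> k / 2 * (norm (w - xb k))\<^sup>2 \<le> h w + \<epsilon> k / 2 * (norm w)\<^sup>2"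
    by metis
  obtain q where q: "q \<in> D" "\<And>z. z \<in> D \<Longrightarrow> h q \<le> h z" and xb_lim: "xb \<longlonglongrightarrow> q"
    and q_norm: "\<And>z. z \<in> D \<Longrightarrow> h z \<le> h q \<Longrightarrow> (norm (z - q))\<^sup>2 + (norm q)\<^sup>2 \<le> (norm z)\<^sup>2"
    using tikhonov_path_tendsto [OF epi q0 eps xb] by metis
  define w where "w k = y k - s *\<^sub>R grad_g (y k) - (s * \<epsilon> k) *\<^sub>R y k" for k
  have sL: "s * L < 1" using s L by (simp add: field_simps)
  \<comment> \<open>The minimal value \<open>h q0\<close> supplies the lower bound that makes every
    proximal point well defined.\<close>
  have bdd: "h q0 - g p - (norm (grad_g p))\<^sup>2 / (4 * (1 / (2 * s) - L / 2))
      \<le> rval f z + 1 / (2 * s) * (norm (z - p))\<^sup>2" if "z \<in> edom f" for z p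
    using q0(2) that unfolding D_def
    by (intro prox_objective_bounded_below [OF g(2) L(2) s(1) sL]) (simp add: h_def)
  note prox = prox_variational [OF f s(1) bdd]
  have x_D: "x k \<in> D" if "k \<ge> 2" for k
    using prox(1) x [of "k - 1"] that unfolding D_def by simp
  have sub: "rval f (x (Suc k)) + ((w k - x (Suc k)) /\<^sub>R s) \<bullet> (z - x (Suc k)) \<le> rval f z"
    if "k \<ge> 1" "z \<in> D" for k z
    using prox(2) [of z "w k"] x [OF that(1)] that(2) unfolding D_def w_def by simp
  \<comment> \<open>From \<open>k0\<close> on, monotonicity of \<open>\<epsilon>\<close> gives
    \<open>s * (L + \<epsilon> k) \<le> 1\<close>.\<close>
  have step: "eventually (\<lambda>k. \<forall>v\<in>D. h (x (Suc k)) + \<epsilon> k / 2 * (norm (x (Suc k)))\<^sup>2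
      + 1 / (2 * s) * (norm (v - x (Suc k)))\<^sup>2
      \<le> h v + \<epsilon> k / 2 * (norm v)\<^sup>2 + 1 / (2 * s) * (norm (v - y k))\<^sup>2) sequentially"
    using eventually_ge_at_top [of k0]
  proof (eventually_elim, intro ballI)
    fix k v assume k: "k0 \<le> k" and v: "v \<in> D"
    have k1: "1 \<le> k" "1 \<le> k0" using k k0 by auto
    have "\<epsilon> k \<le> \<epsilon> k0" using eps(2) k k1 by (auto simp: monotone_on_def)
    then have "s * (L + \<epsilon> k) \<le> s * (L + \<epsilon> k0)" using s by simp
    also have "\<dots> \<le> 1" using k0(2) eps(1) [OF k1(2)] L(1) by (simp add: field_simps)
    finally show "h (x (Suc k)) + \<epsilon> k / 2 * (norm (x (Suc k)))\<^sup>2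
      + 1 / (2 * s) * (norm (v - x (Suc k)))\<^sup>2
      \<le> h v + \<epsilon> k / 2 * (norm v)\<^sup>2 + 1 / (2 * s) * (norm (v - y k))\<^sup>2"
      using sub [OF k1(1) v] eps(1) [OF k1(1)] unfolding h_def w_def
      by (intro proximal_gradient_ineq [OF g(1,2) L(2) s(1)]) auto
  qed
  \<comment> \<open>The limit inferior may be infinite; a value strictly below it is finite and
    yields the real number \<open>m\<close>.\<close>
  obtain r :: ereal where "0 < r" "r < liminf (\<lambda>k. ereal (c k / t k))"
    using liminf_t dense unfolding c_def by blast
  then obtain m where m: "0 < m" "ereal m < liminf (\<lambda>k. ereal (c k / t k))"
    using less_infinityE by (cases r) auto
  have m_t: "eventually (\<lambda>k. m * t k \<le> - (t k)\<^sup>2 + t k + (t (k - 1))\<^sup>2) sequentially"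
    using less_LiminfD [OF m(2)]
  proof eventually_elim
    case (elim k)
    have "1 \<le> t j" for j
    proof (induction j)
      case (Suc j)
      then show ?case using t [of "Suc j"] by simp
    qed (simp add: t0)
    then have "0 < t k" by (meson less_le_trans zero_less_one)
    then show ?case using elim by (simp add: c_def pos_less_divide_eq)
  qed
  have eps_diff': "(\<lambda>k. t k * (\<epsilon> k - \<epsilon> (Suc k)) / \<epsilon> k) \<longlonglongrightarrow> 0"
    using eps_diff by simp
  interpret it: inertial_tikhonov h D s t \<epsilon> x y xb q "k0 - 1" m "\<lambda>k z. h z + \<epsilon> k / 2 * (norm z)\<^sup>2"
    by (rule inertial_tikhonov.intro)
      (fact conv s(1) t0 t eps y x_D step m(1) m_t t_eps_mono t_eps_lim eps_diff' q xb xb_lim)+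
  have "metric_proj (argmin_set (\<lambda>z. f z + ereal (g z))) 0 = {q}"
  proof -
    \<comment> \<open>The inequality \<open>q_norm\<close> gives both the minimality of the norm of
      \<open>q\<close> and its uniqueness.\<close>
    have "p = q" if "p \<in> D" "\<And>z. z \<in> D \<Longrightarrow> h p \<le> h z" "norm p \<le> norm q" for p
    proof -
      have "(norm p)\<^sup>2 \<le> (norm q)\<^sup>2" using that(3) by (intro power_mono) auto
      with q_norm [OF that(1) that(2) [OF q(1)]] have "(norm (p - q))\<^sup>2 \<le> 0" by linarith
      then show ?thesis by simp
    qed
    moreover have "norm q \<le> norm p" if "p \<in> D" "\<And>z. z \<in> D \<Longrightarrow> h p \<le> h z" for p
    proof (rule power2_le_imp_le)
      show "(norm q)\<^sup>2 \<le> (norm p)\<^sup>2"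
        using q_norm [OF that(1) that(2) [OF q(1)]] zero_le_power2 [of "norm (p - q)"] by linarith
    qed simp
    ultimately show ?thesis using q unfolding argmin metric_proj_def by auto
  qed
  then have goal1: "\<exists>xs. {xs} = metric_proj (argmin_set (\<lambda>z. f z + ereal (g z))) 0
      \<and> x \<longlonglongrightarrow> xs \<and> y \<longlonglongrightarrow> xs"
    using it.x_lim it.y_lim by metis
  have F_eq: "F k = (\<lambda>z. f z + ereal (g z + \<epsilon> k / 2 * (norm z)\<^sup>2))" for k
    unfolding F by (simp add: add.assoc fun_eq_iff)
  have F_val: "F k z = ereal (h z + \<epsilon> k / 2 * (norm z)\<^sup>2)" if "z \<in> D" for k z
    using proper_fun_eq_rval [OF f(1), of z] that unfolding F_eq D_def h_def
    by (metis plus_ereal.simps(1) add.assoc)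
  have argmin_F: "argmin_set (F k) = {xb k}" if k: "k \<ge> 1" for k
  proof -
    have "argmin_set (F k) = {p \<in> D. \<forall>z\<in>D.
        h p + \<epsilon> k / 2 * (norm p)\<^sup>2 \<le> h z + \<epsilon> k / 2 * (norm z)\<^sup>2}"
      unfolding F_eq argmin_set_ereal_add [OF f(1)] D_def h_def by (simp add: add.assoc)
    moreover have "p = xb k" if "p \<in> D"
      "h p + \<epsilon> k / 2 * (norm p)\<^sup>2 \<le> h (xb k) + \<epsilon> k / 2 * (norm (xb k))\<^sup>2" for p
    proof -
      have "\<epsilon> k / 2 * (norm (p - xb k))\<^sup>2 \<le> 0" using xb(2) [OF k that(1)] that(2) by linarith
      then show ?thesis using eps(1) [OF k] by (simp add: mult_le_0_iff)
    qed
    moreover have "h (xb k) + \<epsilon> k / 2 * (norm (xb k))\<^sup>2 \<le> h z + \<epsilon> k / 2 * (norm z)\<^sup>2"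
      if "z \<in> D" for z
      using eps(1) [OF k] by (intro order.trans [OF _ xb(2) [OF k that]]) simp
    ultimately show ?thesis using xb(1) [OF k] by blast
  qed
  \<comment> \<open>The starting points \<open>x 0\<close> and \<open>x 1\<close> may lie outside
    the domain of \<open>f\<close>, so the values are identified from index 2 on.\<close>
  have "eventually (\<lambda>k. real_of_ereal (F k (x k) - F k (xb k)) =
      h (x k) + \<epsilon> k / 2 * (norm (x k))\<^sup>2 - (h (xb k) + \<epsilon> k / 2 * (norm (xb k))\<^sup>2)) sequentially"
    using eventually_ge_at_top [of 2]
  proof eventually_elim
    case (elim k)
    then have "xb k \<in> D" by (intro xb(1)) simp
    then show ?case using x_D [OF elim] by (simp add: F_val)
  qed
  then have gap: "(\<lambda>k. real_of_ereal (F k (x k) - F k (xb k))) \<in> o(\<epsilon>)"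
    using it.gap_small by (simp add: landau_o.small.in_cong)
  have fg_val: "f z + ereal (g z) = ereal (h z)" if "z \<in> D" for z
    using proper_fun_eq_rval [OF f(1), of z] that unfolding D_def h_def
    by (metis plus_ereal.simps(1))
  have "(INF z. f z + ereal (g z)) = ereal (h q)"
  proof (rule INF_eqI)
    fix z
    show "ereal (h q) \<le> f z + ereal (g z)"
      using q(2) [of z] by (cases "z \<in> D") (simp_all add: fg_val, simp add: D_def)
  next
    fix v assume "\<And>z. z \<in> UNIV \<Longrightarrow> v \<le> f z + ereal (g z)"
    from this [of q] show "v \<le> ereal (h q)" by (simp add: fg_val q(1))
  qed
  then have "eventually (\<lambda>k. real_of_ereal (f (x k) + ereal (g (x k)) - (INF z. f z + ereal (g z)))
      = h (x k) - h q) sequentially"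
    by (auto intro!: eventually_sequentiallyI [of 2] simp: fg_val x_D)
  then have value_big: "(\<lambda>k. real_of_ereal (f (x k) + ereal (g (x k)) - (INF z. f z + ereal (g z)))) \<in> O(\<epsilon>)"
    using it.value_big by (simp add: landau_o.big.in_cong)
  \<comment> \<open>The proximal residual of the step producing \<open>x k\<close> is the
    subgradient of \<open>f\<close>.\<close>
  define u where "u k = (w (k - 1) - x k) /\<^sub>R s + grad_g (x k)" for k
  have u_mem: "u k \<in> (\<lambda>v. v + grad_g (x k)) ` subdifferential f (x k)" if "k \<ge> 2" for k
  proof -
    have "(w (k - 1) - x k) /\<^sub>R s \<in> subdifferential f (x k)"
      using sub [of "k - 1"] x_D [OF that] that unfolding D_def
      by (intro mem_subdifferentialI f) auto
    then show ?thesis by (simp add: u_def)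
  qed
  have "norm (u k) \<le> (1 / s + L) * norm (y (k - 1) - x k) + \<epsilon> (k - 1) * norm (y (k - 1))"
    if k: "k \<ge> 2" for k
  proof -
    obtain j where j: "k = Suc j" "1 \<le> j" using k by (cases k) auto
    \<comment> \<open>The Lipschitz bound on the gradient difference gives the constant
      \<open>1 / s + L\<close>; the penalty gradient stays as a separate term.\<close>
    have "u k = (1 / s) *\<^sub>R (y j - x k) - (grad_g (y j) - grad_g (x k)) - \<epsilon> j *\<^sub>R y j"
      using s(1) by (simp add: u_def w_def j algebra_simps inverse_eq_divide)
    also have "norm \<dots> \<le> norm ((1 / s) *\<^sub>R (y j - x k)) + norm (grad_g (y j) - grad_g (x k))
        + norm (\<epsilon> j *\<^sub>R y j)"
      by (meson add_right_mono norm_triangle_ineq4 order.trans)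
    also have "norm (grad_g (y j) - grad_g (x k)) \<le> L * norm (y j - x k)"
      using lipschitz_onD [OF L(2), of "y j" "x k"] by (simp add: dist_norm)
    finally show ?thesis using s(1) eps(1) [OF j(2)] by (simp add: j(1) distrib_right)
  qed
  then have u_small: "(\<lambda>k. norm (u k)) \<in> o(\<lambda>k. sqrt (\<epsilon> k))"
    by (intro it.residual_small [of "1 / s + L"]) (use s(1) L(1) in auto)
  have fin: "\<forall>k\<ge>2. f (x k) \<noteq> \<infinity>" using x_D unfolding D_def by blast
  show ?thesis
    using goal1 it.x_minus_y_small fin argmin_F gap value_big it.step_small u_mem u_small by blast
qed

end
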